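(* Let $G = \langle a_1,\dots,a_m \mid r_1,\dots,r_n\rangle$ be a finitely presented group. Then $$\mathfrak{X}(G) = \langle a_1,\dots,a_m, \overline{a}_1,\dots,\overline{a}_m \mid r_1,\dots,r_n,\ \overline{r}_1,\dots,\overline{r}_n,\ [w,\overline{w}]\ \text{ for } w\in\Upsilon_m\rangle,$$ where $\Upsilon_m$ consists of the words $a_i$ ($1\le i\le m$) and $a_ia_j,\ a_ia_j^{-1},\ a_i^{-1}a_j,\ a_ja_i$ ($1\le i<j\le m$), together with all words of the form $w=\beta_0w_0\alpha_0$ where $w_0$ is a monomial word $a_{i_1}a_{i_2}\cdots a_{i_s}$ with $s\ge 1$ and $1\le i_1<i_2<\dots<i_s\le m$, and $\alpha_0=a_j^{\pm1}$ and $\beta_0=a_k^{\pm1}$ with $j,k\in\{1,\dots,m\}\setminus\{i_1,\dots,i_s\}$ (the case $j=k$ is allowed).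
   Context: For a group $G$, let $\overline{G}$ be a second copy of $G$ with a fixed isomorphism $g\mapsto\overline{g}$ from $G$ to $\overline{G}$. The group $\mathfrak{X}(G)$ is the quotient of the free product $G\ast\overline{G}$ by the normal closure of the set $\{[g,\overline{g}] : g\in G\}$. For a word $w$ in the letters $a_i^{\pm1}$, $\overline{w}$ denotes the word obtained from $w$ by replacing each $a_i^{\pm 1}$ by $\overline{a}_i^{\pm1}$. Commutators are $[x,y]=x^{-1}y^{-1}xy$. In the presentation, the generators $a_i,\overline{a}_i$ map to the elements $a_i\in G$ and $\overline{a}_i\in\overline{G}$ of $\mathfrak{X}(G)$. *)

theory Defs
  imports "HOL-Algebra.Coset"
begin

section \<open>Free groups and presentations\<close>

datatype 'x letter = Gen (symb: 'x) | GenInv (symb: 'x)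

type_synonym 'x word = "'x letter list"

fun inv_letter :: "'x letter \<Rightarrow> 'x letter" where
  "inv_letter (Gen x) = GenInv x"
| "inv_letter (GenInv x) = Gen x"

definition inv_word :: "'x word \<Rightarrow> 'x word" where
  "inv_word w = rev (map inv_letter w)"

definition words :: "'x set \<Rightarrow> 'x word set" where
  "words X = lists {l. symb l \<in> X}"

inductive free_step :: "'x set \<Rightarrow> 'x word \<Rightarrow> 'x word \<Rightarrow> bool" for X where
  "symb l \<in> X \<Longrightarrow> free_step X (us @ [l, inv_letter l] @ vs) (us @ vs)"

definition free_class :: "'x set \<Rightarrow> 'x word \<Rightarrow> 'x word set" where
  "free_class X w = {v. equivclp (free_step X) w v}"

text \<open>The product of two classes is the class of the concatenation of any representatives.\<close>

definition free_group :: "'x set \<Rightarrow> 'x word set monoid" where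
  "free_group X =
     \<lparr>carrier = free_class X ` words X,
      mult = (\<lambda>A B. \<Union>u\<in>A. \<Union>v\<in>B. free_class X (u @ v)),
      one = free_class X []\<rparr>"

text \<open>Intended for \<^term>\<open>S \<subseteq> carrier G\<close>; otherwise the intersection is over the empty family.\<close>

definition normal_closure :: "('a, 'b) monoid_scheme \<Rightarrow> 'a set \<Rightarrow> 'a set" where
  "normal_closure G S = \<Inter>{N. N \<lhd> G \<and> S \<subseteq> N}"

definition relator_closure :: "'x set \<Rightarrow> 'x word set \<Rightarrow> 'x word set set" where
  "relator_closure X R = normal_closure (free_group X) (free_class X ` R)"

definition presented_group :: "'x set \<Rightarrow> 'x word set \<Rightarrow> 'x word set set monoid" where
  "presented_group X R = free_group X Mod relator_closure X R"

definition presented_gen :: "'x set \<Rightarrow> 'x word set \<Rightarrow> 'x \<Rightarrow> 'x word set set" where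
  "presented_gen X R x = relator_closure X R #>\<^bsub>free_group X\<^esub> free_class X [Gen x]"

text \<open>\<open>G = \<langle>X | R\<rangle>\<close>, where the generator \<open>x\<close> stands for the element \<open>a x\<close> of \<open>G\<close>.\<close>

definition has_presentation ::
    "('g, 'b) monoid_scheme \<Rightarrow> 'x set \<Rightarrow> ('x \<Rightarrow> 'g) \<Rightarrow> 'x word set \<Rightarrow> bool" where
  "has_presentation G X a R \<longleftrightarrow>
     group G \<and> R \<subseteq> words X \<and>
     (\<exists>\<psi> \<in> iso (presented_group X R) G. \<forall>x\<in>X. \<psi> (presented_gen X R x) = a x)"


section \<open>Free products\<close>

text \<open>Words in the disjoint union of the two carriers, modulo multiplying adjacent letters
  from the same factor and deleting identity letters.\<close>

inductive fprod_step ::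
    "('g, 'p) monoid_scheme \<Rightarrow> ('h, 'q) monoid_scheme \<Rightarrow> ('g + 'h) list \<Rightarrow> ('g + 'h) list \<Rightarrow> bool"
  for G H where
  "x \<in> carrier G \<Longrightarrow> y \<in> carrier G \<Longrightarrow>
     fprod_step G H (us @ [Inl x, Inl y] @ vs) (us @ [Inl (x \<otimes>\<^bsub>G\<^esub> y)] @ vs)"
| "fprod_step G H (us @ [Inl \<one>\<^bsub>G\<^esub>] @ vs) (us @ vs)"
| "x \<in> carrier H \<Longrightarrow> y \<in> carrier H \<Longrightarrow>
     fprod_step G H (us @ [Inr x, Inr y] @ vs) (us @ [Inr (x \<otimes>\<^bsub>H\<^esub> y)] @ vs)"
| "fprod_step G H (us @ [Inr \<one>\<^bsub>H\<^esub>] @ vs) (us @ vs)"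

definition fprod_class ::
    "('g, 'p) monoid_scheme \<Rightarrow> ('h, 'q) monoid_scheme \<Rightarrow> ('g + 'h) list \<Rightarrow> ('g + 'h) list set" where
  "fprod_class G H w = {v. equivclp (fprod_step G H) w v}"

definition free_product ::
    "('g, 'p) monoid_scheme \<Rightarrow> ('h, 'q) monoid_scheme \<Rightarrow> ('g + 'h) list set monoid" where
  "free_product G H =
     \<lparr>carrier = fprod_class G H ` lists (carrier G <+> carrier H),
      mult = (\<lambda>A B. \<Union>u\<in>A. \<Union>v\<in>B. fprod_class G H (u @ v)),
      one = fprod_class G H []\<rparr>"


section \<open>The weak commutativity construction\<close>

definition commutator :: "('g, 'b) monoid_scheme \<Rightarrow> 'g \<Rightarrow> 'g \<Rightarrow> 'g" where
  "commutator G x y = inv\<^bsub>G\<^esub> x \<otimes>\<^bsub>G\<^esub> inv\<^bsub>G\<^esub> y \<otimes>\<^bsub>G\<^esub> x \<otimes>\<^bsub>G\<^esub> y"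

text \<open>Below, \<open>H\<close> is the second copy of \<open>G\<close> and \<open>\<phi> \<in> iso G H\<close> the fixed
  isomorphism sending \<open>g\<close> to its barred counterpart.\<close>

definition weak_comm_kernel ::
    "('g, 'p) monoid_scheme \<Rightarrow> ('h, 'q) monoid_scheme \<Rightarrow> ('g \<Rightarrow> 'h) \<Rightarrow> ('g + 'h) list set set" where
  "weak_comm_kernel G H \<phi> =
     normal_closure (free_product G H)
       {commutator (free_product G H) (fprod_class G H [Inl g]) (fprod_class G H [Inr (\<phi> g)])
        | g. g \<in> carrier G}"

definition weak_comm_group ::
    "('g, 'p) monoid_scheme \<Rightarrow> ('h, 'q) monoid_scheme \<Rightarrow> ('g \<Rightarrow> 'h) \<Rightarrow>
     ('g + 'h) list set set monoid" where
  "weak_comm_group G H \<phi> = free_product G H Mod weak_comm_kernel G H \<phi>"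

definition weak_comm_elem ::
    "('g, 'p) monoid_scheme \<Rightarrow> ('h, 'q) monoid_scheme \<Rightarrow> ('g \<Rightarrow> 'h) \<Rightarrow> 'g + 'h \<Rightarrow>
     ('g + 'h) list set set" where
  "weak_comm_elem G H \<phi> z = weak_comm_kernel G H \<phi> #>\<^bsub>free_product G H\<^esub> fprod_class G H [z]"


section \<open>The words occurring in the presentation\<close>

text \<open>In the doubled alphabet, \<open>Inl i\<close> is the symbol \<open>a\<^sub>i\<close> and \<open>Inr i\<close> its barred version.\<close>

definition unbar_word :: "'x word \<Rightarrow> ('x + 'x) word" where
  "unbar_word w = map (map_letter Inl) w"

definition bar_word :: "'x word \<Rightarrow> ('x + 'x) word" where
  "bar_word w = map (map_letter Inr) w"

definition commutator_word :: "'x word \<Rightarrow> 'x word \<Rightarrow> 'x word" where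
  "commutator_word u v = inv_word u @ inv_word v @ u @ v"

definition Upsilon :: "nat \<Rightarrow> nat word set" where
  "Upsilon m =
     {[Gen i] | i. 1 \<le> i \<and> i \<le> m} \<union>
     (\<Union>(i, j) \<in> {(i, j). 1 \<le> i \<and> i < j \<and> j \<le> m}.
        {[Gen i, Gen j], [Gen i, GenInv j], [GenInv i, Gen j], [Gen j, Gen i]}) \<union>
     {[\<beta>] @ map Gen ks @ [\<alpha>] | \<beta> ks \<alpha>.
        ks \<noteq> [] \<and> sorted_wrt (<) ks \<and> set ks \<subseteq> {1..m} \<and>
        symb \<alpha> \<in> {1..m} - set ks \<and> symb \<beta> \<in> {1..m} - set ks}"

end

(* Let u w and b w be the values of a word w and of its barred copy in the presented group, and put
   delta w = u(w)^-1 b(w). For words on which u and b commute, moving a letter past a word changes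
   delta only by deltas of shorter words, so the deltas of the increasing monomials
   a_{i_1} ... a_{i_s} generate a subgroup that is invariant under conjugation and contains every
   delta w. The relators for beta_0 w_0 alpha_0 say that the commutators of a_k^e with the barred
   a_j^e' centralise delta of the increasing monomials without a_j, a_k; the same moves extend this to
   all increasing monomials, hence to all words. Conjugation by a letter and by its barred copy then
   agree on commutators, so [u v, b w] = [b v, u w] extends from letters to words. Given that u and b
   commute on v and on w, this identity says that they commute on v w^-1, so they commute on every
   word, and both groups have the same universal property. *)

theory Submission
  imports Defs "HOL-Algebra.Generated_Groups"
begin

section \<open>Words in a group\<close>

text \<open>Conjugation by \<open>u w\<close> and by \<open>b w\<close> agree on an element exactly
  when it commutes with \<open>b w\<close> times the inverse of \<open>u w\<close>, which is
  \<open>delta w\<close> as soon as \<open>u w\<close> and \<open>b w\<close> commute; this turns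
  exchanging barred and unbarred letters into centraliser statements. The obstacle is that
  commutation is at first known only for the words of \<open>Upsilon m\<close> and their inverses,
  whereas rewriting deltas meets other words. The rule delta(v w) = delta(v)^u(w) delta(w) gets
  around it: an identity between the deltas of v, w, v w, w v can be conjugated by u(z), so moving v
  past w inside v w z needs commutation for v, w, v w and v^-1 w alone, and the tail z is arbitrary.
  With v an initial piece of an increasing monomial and w a single letter, these four words are
  available. The outer letters of beta_0 w_0 alpha_0 enter by splitting it into beta_0 w_0 and
  alpha_0: commuting on a quotient of two words is the exchange identity for the pair, and comparing
  the identities for beta_0 w_0 and for w_0 isolates the condition on delta(w_0).\<close>

fun letter_val :: "('g, 'b) monoid_scheme \<Rightarrow> ('x \<Rightarrow> 'g) \<Rightarrow> 'x letter \<Rightarrow> 'g" where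
  "letter_val K f (Gen s) = f s"
| "letter_val K f (GenInv s) = inv\<^bsub>K\<^esub> f s"

fun word_val :: "('g, 'b) monoid_scheme \<Rightarrow> ('x \<Rightarrow> 'g) \<Rightarrow> 'x word \<Rightarrow> 'g" where
  "word_val K f [] = \<one>\<^bsub>K\<^esub>"
| "word_val K f (l # w) = letter_val K f l \<otimes>\<^bsub>K\<^esub> word_val K f w"

lemma inv_letter_inv_letter [simp]: "inv_letter (inv_letter l) = l"
  by (cases l) auto

lemma symb_inv_letter [simp]: "symb (inv_letter l) = symb l"
  by (cases l) auto

lemma words_Nil [simp]: "[] \<in> words X"
  by (simp add: words_def)

lemma words_Cons [simp]: "l # w \<in> words X \<longleftrightarrow> symb l \<in> X \<and> w \<in> words X"
  by (simp add: words_def)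

lemma words_append [simp]: "v @ w \<in> words X \<longleftrightarrow> v \<in> words X \<and> w \<in> words X"
  by (simp add: words_def)

lemma words_map_Gen: "map Gen ks \<in> words X \<longleftrightarrow> set ks \<subseteq> X"
  by (induction ks) auto

lemma inv_word_Nil [simp]: "inv_word [] = []"
  by (simp add: inv_word_def)

lemma inv_word_Cons [simp]: "inv_word (l # w) = inv_word w @ [inv_letter l]"
  by (simp add: inv_word_def)

lemma inv_word_append [simp]: "inv_word (v @ w) = inv_word w @ inv_word v"
  by (simp add: inv_word_def)

lemma words_inv_word [simp]: "inv_word w \<in> words X \<longleftrightarrow> w \<in> words X"
  by (induction w) auto

context group
begin

text \<open>With \<open>m_assoc\<close> products are nested to the right; these two rules cancel
  inside such a product, which lets \<open>simp\<close> prove the identities between group words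
  below.\<close>

lemma inv_cancel_left [simp]:
  assumes "g \<in> carrier G" "h \<in> carrier G"
  shows "inv g \<otimes> (g \<otimes> h) = h" "g \<otimes> (inv g \<otimes> h) = h"
  using assms by (simp_all flip: m_assoc)

lemma commute_inv_left:
  assumes "g \<otimes> h = h \<otimes> g" "g \<in> carrier G" "h \<in> carrier G"
  shows "inv g \<otimes> h = h \<otimes> inv g"
proof -
  have "inv g \<otimes> h = inv g \<otimes> (h \<otimes> g) \<otimes> inv g"
    using assms(2,3) by (simp add: m_assoc)
  also have "\<dots> = h \<otimes> inv g"
    using assms(2,3) by (simp add: m_assoc flip: assms(1))
  finally show ?thesis .
qed

definition centralizer :: "'a \<Rightarrow> 'a set" where
  "centralizer z = {g \<in> carrier G. g \<otimes> z = z \<otimes> g}"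

lemma subgroup_centralizer:
  assumes "z \<in> carrier G"
  shows "subgroup (centralizer z) G"
proof (rule subgroupI)
  show "centralizer z \<subseteq> carrier G" "centralizer z \<noteq> {}"
    using assms by (auto simp: centralizer_def)
next
  fix g assume "g \<in> centralizer z"
  then show "inv g \<in> centralizer z"
    using assms commute_inv_left by (auto simp: centralizer_def)
next
  fix g h assume gh: "g \<in> centralizer z" "h \<in> centralizer z"
  then have "(g \<otimes> h) \<otimes> z = g \<otimes> z \<otimes> h"
    using assms unfolding centralizer_def by (metis (mono_tags, lifting) m_assoc mem_Collect_eq)
  then show "g \<otimes> h \<in> centralizer z"
    using assms gh by (simp add: centralizer_def m_assoc)
qed

lemma commutator_closed [simp]:
  "g \<in> carrier G \<Longrightarrow> h \<in> carrier G \<Longrightarrow> commutator G g h \<in> carrier G"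
  by (simp add: commutator_def)

lemma commutator_eq_one_iff:
  assumes "g \<in> carrier G" "h \<in> carrier G"
  shows "commutator G g h = \<one> \<longleftrightarrow> g \<otimes> h = h \<otimes> g"
proof -
  have "commutator G g h = inv (h \<otimes> g) \<otimes> (g \<otimes> h)"
    using assms by (simp add: commutator_def inv_mult_group m_assoc)
  then show ?thesis
    using assms by (metis inv_closed inv_equality inv_inv l_inv m_closed)
qed

lemma inv_commutator:
  assumes "g \<in> carrier G" "h \<in> carrier G"
  shows "inv (commutator G g h) = commutator G h g"
  using assms by (simp add: commutator_def inv_mult_group m_assoc)

text \<open>The rule [g h, k] = [g, k]^h [h, k]; every induction on the first argument of a
  commutator rests on it.\<close>

lemma commutator_mult_left:
  assumes "g \<in> carrier G" "h \<in> carrier G" "k \<in> carrier G"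
  shows "commutator G (g \<otimes> h) k = inv h \<otimes> commutator G g k \<otimes> h \<otimes> commutator G h k"
  using assms by (simp add: commutator_def inv_mult_group m_assoc)

lemma letter_val_closed:
  assumes "\<And>s. s \<in> X \<Longrightarrow> f s \<in> carrier G" "symb l \<in> X"
  shows "letter_val G f l \<in> carrier G"
  using assms by (cases l) auto

lemma word_val_closed:
  assumes "\<And>s. s \<in> X \<Longrightarrow> f s \<in> carrier G" "w \<in> words X"
  shows "word_val G f w \<in> carrier G"
  using assms(2) by (induction w) (auto intro: letter_val_closed assms(1))

lemma word_val_append:
  assumes "\<And>s. s \<in> X \<Longrightarrow> f s \<in> carrier G" "v \<in> words X" "w \<in> words X"
  shows "word_val G f (v @ w) = word_val G f v \<otimes> word_val G f w"
  using assms(2)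
  by (induction v)
    (auto simp: m_assoc letter_val_closed[of X f, OF assms(1)] word_val_closed[of X f, OF assms(1)] assms)

lemma letter_val_inv_letter:
  assumes "\<And>s. s \<in> X \<Longrightarrow> f s \<in> carrier G" "symb l \<in> X"
  shows "letter_val G f (inv_letter l) = inv (letter_val G f l)"
  using assms by (cases l) auto

lemma word_val_inv_word:
  assumes "\<And>s. s \<in> X \<Longrightarrow> f s \<in> carrier G" "w \<in> words X"
  shows "word_val G f (inv_word w) = inv (word_val G f w)"
  using assms(2)
  by (induction w)
    (auto simp: inv_mult_group word_val_append[of X f, OF assms(1)] letter_val_inv_letter[of X f, OF assms(1)]
       letter_val_closed[of X f, OF assms(1)] word_val_closed[of X f, OF assms(1)])

end

lemma strict_sorted_split:
  fixes ks :: "'a :: linorder list"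
  assumes "sorted_wrt (<) ks" "k \<notin> set ks"
  obtains as bs where "ks = as @ bs" "sorted_wrt (<) (as @ k # bs)"
proof
  show "ks = filter (\<lambda>i. i < k) ks @ filter (\<lambda>i. k < i) ks"
    using assms
  proof (induction ks)
    case (Cons a ks)
    then have "filter (\<lambda>i. i < k) ks = []" if "k < a"
      using that by (auto simp: filter_empty_conv)
    moreover have "filter (\<lambda>i. k < i) ks = ks" if "k < a"
      using Cons.prems that by (auto intro!: filter_True)
    ultimately show ?case
      using Cons by (cases a k rule: linorder_cases) auto
  qed simp
  show "sorted_wrt (<) (filter (\<lambda>i. i < k) ks @ k # filter (\<lambda>i. k < i) ks)"
    using assms by (auto simp: sorted_wrt_append sorted_wrt_filter)
qed

section \<open>Commuting of words with their barred copies\<close>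

text \<open>Stated for any group with two families \<open>x\<close> and \<open>y\<close>, because
  the argument is about words only; the final proof instantiates it with the generators of the
  presented group.\<close>

locale doubled_generators = group P for P (structure) +
  fixes m :: nat and x y :: "nat \<Rightarrow> 'a"
  assumes x_closed: "\<And>i. i \<in> {1..m} \<Longrightarrow> x i \<in> carrier P"
    and y_closed: "\<And>i. i \<in> {1..m} \<Longrightarrow> y i \<in> carrier P"
    and Upsilon_commute:
      "\<And>w. w \<in> Upsilon m \<Longrightarrow> word_val P x w \<otimes> word_val P y w = word_val P y w \<otimes> word_val P x w"
begin

text \<open>The values \<open>u [c]\<close> and \<open>b [c]\<close> of one-letter words stay
  atomic, and the bound of \<open>{1..m}\<close> keeps its form, so that the rules below
  match.\<close>

declare One_nat_def [simp del] word_val.simps(2) [simp del]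

abbreviation W :: "nat word set" where "W \<equiv> words {1..m}"
abbreviation u :: "nat word \<Rightarrow> 'a" where "u \<equiv> word_val P x"
abbreviation b :: "nat word \<Rightarrow> 'a" where "b \<equiv> word_val P y"

section \<open>Calculus of the elements \<open>delta w\<close>\<close>

definition commutes_bar :: "nat word \<Rightarrow> bool" where
  "commutes_bar w \<longleftrightarrow> w \<in> W \<and> u w \<otimes> b w = b w \<otimes> u w"

definition delta :: "nat word \<Rightarrow> 'a" where
  "delta w = inv (u w) \<otimes> b w"

lemma u_closed [simp]: "w \<in> W \<Longrightarrow> u w \<in> carrier P"
  and b_closed [simp]: "w \<in> W \<Longrightarrow> b w \<in> carrier P"
  using word_val_closed[of "{1..m}"] x_closed y_closed by blast+

lemma u_append [simp]: "v \<in> W \<Longrightarrow> w \<in> W \<Longrightarrow> u (v @ w) = u v \<otimes> u w"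
  and b_append [simp]: "v \<in> W \<Longrightarrow> w \<in> W \<Longrightarrow> b (v @ w) = b v \<otimes> b w"
  using word_val_append[of "{1..m}"] x_closed y_closed by blast+

lemma u_inv_word [simp]: "w \<in> W \<Longrightarrow> u (inv_word w) = inv (u w)"
  and b_inv_word [simp]: "w \<in> W \<Longrightarrow> b (inv_word w) = inv (b w)"
  using word_val_inv_word[of "{1..m}"] x_closed y_closed by blast+

lemma u_inv_letter [simp]: "symb c \<in> {1..m} \<Longrightarrow> u [inv_letter c] = inv (u [c])"
  and b_inv_letter [simp]: "symb c \<in> {1..m} \<Longrightarrow> b [inv_letter c] = inv (b [c])"
  using u_inv_word[of "[c]"] b_inv_word[of "[c]"] by simp_all



lemma commutes_bar_words: "commutes_bar w \<Longrightarrow> w \<in> W"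
  by (simp add: commutes_bar_def)

lemma commutes_bar_commute: "commutes_bar w \<Longrightarrow> u w \<otimes> b w = b w \<otimes> u w"
  by (simp add: commutes_bar_def)

lemma delta_closed [simp]: "w \<in> W \<Longrightarrow> delta w \<in> carrier P"
  by (simp add: delta_def)

lemma delta_Nil [simp]: "delta [] = \<one>"
  by (simp add: delta_def)

lemma commutes_bar_Nil: "commutes_bar []"
  by (simp add: commutes_bar_def)

lemma commutes_bar_inv_word: "commutes_bar w \<Longrightarrow> commutes_bar (inv_word w)"
  unfolding commutes_bar_def by (auto simp flip: inv_mult_group)

lemma delta_commutes_bar:
  assumes "commutes_bar w"
  shows "delta w = b w \<otimes> inv (u w)"
  using assms commute_inv_left[of "u w" "b w"] by (simp add: commutes_bar_def delta_def)

lemma delta_inv_word: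
  assumes "commutes_bar w"
  shows "delta (inv_word w) = inv (delta w)"
  using assms by (simp add: delta_commutes_bar[OF commutes_bar_inv_word[OF assms]] delta_def[of w] inv_mult_group commutes_bar_words)

text \<open>\<open>delta\<close> is a crossed homomorphism for the action by conjugation with
  \<open>u w\<close>. The rule needs no commutation, which is what later permits arbitrary
  tails.\<close>

lemma delta_append:
  assumes "v \<in> W" "w \<in> W"
  shows "delta (v @ w) = inv (u w) \<otimes> delta v \<otimes> u w \<otimes> delta w"
  using assms by (simp add: delta_def inv_mult_group m_assoc)

lemma delta_conj:
  assumes "v \<in> W" "w \<in> W"
  shows "inv (u w) \<otimes> delta v \<otimes> u w = delta (v @ w) \<otimes> inv (delta w)"
  using assms by (simp add: delta_append m_assoc)

text \<open>Commutation on w and on v^-1 w allows writing their deltas as b u^-1 instead of u^-1 b.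
  Then delta(v^-1 w) is delta(w) between b(v)^-1 and u(v), while delta(w v) is delta(w) between
  u(v)^-1 and b(v); a factor delta(v) on each side converts one into the other.\<close>

lemma delta_swap:
  assumes "v \<in> W" "commutes_bar w" "commutes_bar (inv_word v @ w)"
  shows "delta (w @ v) = delta v \<otimes> delta (inv_word v @ w) \<otimes> delta v"
proof -
  have w: "w \<in> W"
    using assms(2) by (rule commutes_bar_words)
  have "delta (w @ v) = inv (u v) \<otimes> delta w \<otimes> b v"
    using assms(1) w by (simp add: delta_def inv_mult_group m_assoc)
  moreover have "delta (inv_word v @ w) = inv (b v) \<otimes> delta w \<otimes> u v"
    using assms(1) w by (simp add: delta_commutes_bar assms m_assoc inv_mult_group)
  ultimately show ?thesis
    using assms(1) w by (simp add: delta_def[of v] m_assoc)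
qed

lemma delta_append_commutes_bar:
  assumes "v \<in> W" "commutes_bar w" "commutes_bar (v @ w)"
  shows "delta (v @ w) = b v \<otimes> delta w \<otimes> inv (u v)"
  using assms(1) commutes_bar_words[OF assms(2)] by (simp add: delta_commutes_bar assms m_assoc inv_mult_group)

text \<open>Inverting the first factor v: in the inverse of delta(v^-1 w) the product b(v) u(v)^-1
  appears, and commutation on v turns it into delta(v).\<close>

lemma delta_flip:
  assumes "commutes_bar v" "commutes_bar w" "commutes_bar (v @ w)"
  shows "delta (v @ w) = delta w \<otimes> inv (delta (inv_word v @ w)) \<otimes> delta w"
proof -
  have vw: "v \<in> W" "w \<in> W"
    using assms commutes_bar_words by blast+
  have "inv (delta (inv_word v @ w)) = inv (b w) \<otimes> (b v \<otimes> inv (u v)) \<otimes> u w"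
    using vw by (simp add: delta_def m_assoc inv_mult_group)
  then have "inv (delta (inv_word v @ w)) = inv (b w) \<otimes> delta v \<otimes> u w"
    by (simp add: delta_commutes_bar[OF assms(1)])
  moreover have "delta w = b w \<otimes> inv (u w)" "delta w = inv (u w) \<otimes> b w"
    using assms(2) by (rule delta_commutes_bar, simp add: delta_def)
  ultimately have "delta w \<otimes> inv (delta (inv_word v @ w)) \<otimes> delta w
      = inv (u w) \<otimes> b w \<otimes> (inv (b w) \<otimes> delta v \<otimes> u w) \<otimes> (inv (u w) \<otimes> b w)"
    by simp
  also have "\<dots> = inv (u w) \<otimes> delta v \<otimes> b w"
    using vw by (simp add: m_assoc)
  also have "\<dots> = delta (v @ w)"
    using vw by (simp add: delta_def m_assoc inv_mult_group)
  finally show ?thesis ..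
qed

text \<open>Complements \<open>delta_conj\<close>: conjugating by the unbarred value of a prefix
  leads to shorter words, where conjugating by any other word leads to longer ones.\<close>

lemma delta_conj_prefix:
  assumes "v \<in> W" "commutes_bar w" "commutes_bar (v @ w)"
  shows "inv (u v) \<otimes> delta (v @ w) \<otimes> u v = delta v \<otimes> delta w"
  using assms(1) commutes_bar_words[OF assms(2)] by (simp add: delta_append_commutes_bar assms m_assoc delta_def[of v])

section \<open>Increasing monomials and the words of \<open>Upsilon m\<close>\<close>

definition incr :: "nat list \<Rightarrow> bool" where
  "incr ks \<longleftrightarrow> sorted_wrt (<) ks \<and> set ks \<subseteq> {1..m}"

abbreviation mono :: "nat list \<Rightarrow> nat word" where
  "mono ks \<equiv> map Gen ks"

lemma incr_words [simp]: "incr ks \<Longrightarrow> mono ks \<in> W"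
  by (simp add: incr_def words_map_Gen)

lemma incr_removeD:
  assumes "incr (as @ k # bs)"
  shows "incr as" "incr bs" "incr (k # bs)" "incr (as @ bs)" "k \<in> {1..m}"
    "k \<notin> set as" "k \<notin> set bs"
  using assms by (auto simp: incr_def sorted_wrt_append)

lemma incr_insert:
  assumes "incr ks" "k \<in> {1..m}" "k \<notin> set ks"
  obtains as bs where "ks = as @ bs" "incr (as @ k # bs)"
  using assms strict_sorted_split[of ks k] unfolding incr_def
  by (metis list.set(2) set_append insert_subset Un_insert_right)

lemma commutes_bar_UpsilonI:
  assumes "w \<in> Upsilon m" "w \<in> W"
  shows "commutes_bar w"
  using assms Upsilon_commute by (simp add: commutes_bar_def)

lemma commutes_bar_letter:
  assumes "symb c \<in> {1..m}"
  shows "commutes_bar [c]"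
proof -
  have "commutes_bar [Gen (symb c)]"
    using assms by (intro commutes_bar_UpsilonI) (auto simp: Upsilon_def)
  with commutes_bar_inv_word[OF this] show ?thesis
    by (cases c) auto
qed

text \<open>For i < j there are eight signed two-letter words on these symbols;
  \<open>Upsilon m\<close> has four of them, and the inverses of these are the other four.\<close>

lemma commutes_bar_pair:
  assumes "symb p \<in> {1..m}" "symb q \<in> {1..m}" "symb p \<noteq> symb q"
  shows "commutes_bar [p, q]"
proof -
  have pos: "commutes_bar [Gen i, Gen j]" "commutes_bar [Gen i, GenInv j]" "commutes_bar [GenInv i, Gen j]" "commutes_bar [Gen j, Gen i]"
    if "i < j" "i \<in> {1..m}" "j \<in> {1..m}" for i j
  proof -
    have "{[Gen i, Gen j], [Gen i, GenInv j], [GenInv i, Gen j], [Gen j, Gen i]} \<subseteq> Upsilon m"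
      unfolding Upsilon_def using that by (intro le_supI1 le_supI2) auto
    then show "commutes_bar [Gen i, Gen j]" "commutes_bar [Gen i, GenInv j]" "commutes_bar [GenInv i, Gen j]" "commutes_bar [Gen j, Gen i]"
      using that by (auto intro: commutes_bar_UpsilonI)
  qed
  have neg: "commutes_bar [GenInv j, GenInv i]" "commutes_bar [Gen j, GenInv i]" "commutes_bar [GenInv j, Gen i]"
      "commutes_bar [GenInv i, GenInv j]"
    if "i < j" "i \<in> {1..m}" "j \<in> {1..m}" for i j
    using pos[OF that, THEN commutes_bar_inv_word] by simp_all
  show ?thesis
    using assms pos neg by (cases p; cases q) (metis letter.sel linorder_neqE_nat)+
qed

lemma commutes_bar_both:
  assumes "incr ks" "ks \<noteq> []" "symb p \<in> {1..m} - set ks" "symb q \<in> {1..m} - set ks"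
  shows "commutes_bar (p # mono ks @ [q])"
proof (rule commutes_bar_UpsilonI)
  show "p # mono ks @ [q] \<in> Upsilon m"
    unfolding Upsilon_def using assms
    by (intro UnI2 CollectI exI[of _ p] exI[of _ ks] exI[of _ q]) (auto simp: incr_def)
qed (use assms in \<open>auto simp: incr_def\<close>)

text \<open>The last letter of the monomial is read as the right outer letter of a word in
  \<open>Upsilon m\<close>, since it does not occur among the preceding ones; a monomial of length
  one falls under the two-letter words.\<close>

lemma commutes_bar_left:
  assumes "incr ks" "symb c \<in> {1..m} - set ks"
  shows "commutes_bar (c # mono ks)"
proof (cases ks rule: rev_cases)
  case Nil
  then show ?thesis
    using assms commutes_bar_letter by simp
next
  case (snoc js k)
  show ?thesis
  proof (cases "js = []")
    case True
    then show ?thesis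
      using snoc assms commutes_bar_pair[of c "Gen k"] by (auto simp: incr_def)
  next
    case False
    moreover have "incr js" "k \<in> {1..m} - set js"
      using assms(1) snoc by (auto simp: incr_def sorted_wrt_append)
    ultimately have "commutes_bar (c # mono js @ [Gen k])"
      using snoc assms(2) by (intro commutes_bar_both) auto
    then show ?thesis
      using snoc by simp
  qed
qed

text \<open>Mirror image of the previous argument: the first letter of the monomial is read as the
  left outer letter.\<close>

lemma commutes_bar_right:
  assumes "incr ks" "symb c \<in> {1..m} - set ks"
  shows "commutes_bar (mono ks @ [c])"
proof (cases ks)
  case Nil
  then show ?thesis
    using assms commutes_bar_letter by simp
next
  case (Cons k js)
  show ?thesis
  proof (cases "js = []")
    case True
    then show ?thesis
      using Cons assms commutes_bar_pair[of "Gen k" c] by (auto simp: incr_def)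
  next
    case False
    moreover have "incr js" "k \<in> {1..m} - set js"
      using assms(1) Cons by (auto simp: incr_def)
    ultimately have "commutes_bar (Gen k # mono js @ [c])"
      using Cons assms(2) by (intro commutes_bar_both) auto
    then show ?thesis
      using Cons by simp
  qed
qed

lemma commutes_bar_incr:
  assumes "incr ks"
  shows "commutes_bar (mono ks)"
proof (cases ks)
  case Nil
  then show ?thesis
    by (simp add: commutes_bar_Nil)
next
  case (Cons k js)
  then show ?thesis
    using assms commutes_bar_left[of js "Gen k"] by (auto simp: incr_def)
qed

text \<open>Provides the commutation on v^-1 w that \<open>delta_move\<close> asks for when w is one
  letter: the word is inverse to a monomial with one letter in front.\<close>

lemma commutes_bar_quotient:
  assumes "incr ks" "symb c \<in> {1..m} - set ks"
  shows "commutes_bar (inv_word (mono ks) @ [c])"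
  using commutes_bar_inv_word[OF commutes_bar_left[of ks "inv_letter c"]] assms by simp

section \<open>Moving factors past each other\<close>

text \<open>Inserting \<open>delta_swap\<close> into \<open>delta_flip\<close> eliminates v^-1 w and
  expresses delta(v w) by delta(v), delta(w) and delta(w v). Here \<gamma> is conjugation of deltas
  by u(z), so the identity is transported to words followed by z without any commutation for
  z.\<close>

lemma delta_move_eq:
  assumes "commutes_bar v" "commutes_bar w" "commutes_bar (v @ w)" "commutes_bar (inv_word v @ w)" "z \<in> W"
  defines "\<gamma> \<equiv> \<lambda>t. delta (t @ z) \<otimes> inv (delta z)"
  shows "\<gamma> (v @ w) = \<gamma> w \<otimes> \<gamma> v \<otimes> inv (\<gamma> (w @ v)) \<otimes> \<gamma> v \<otimes> \<gamma> w"
proof -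
  have vw: "v \<in> W" "w \<in> W"
    using assms commutes_bar_words by blast+
  have \<gamma>: "\<gamma> t = inv (u z) \<otimes> delta t \<otimes> u z" if "t \<in> W" for t
    using that assms(5) by (simp add: \<gamma>_def delta_conj)
  have "delta (w @ v) = delta v \<otimes> delta (inv_word v @ w) \<otimes> delta v"
    using assms vw by (intro delta_swap)
  then have "inv (delta (inv_word v @ w)) = delta v \<otimes> inv (delta (w @ v)) \<otimes> delta v"
    using vw by (simp add: m_assoc inv_mult_group)
  then have "delta (v @ w)
      = delta w \<otimes> (delta v \<otimes> inv (delta (w @ v)) \<otimes> delta v) \<otimes> delta w"
    using assms vw by (simp add: delta_flip)
  then show ?thesis
    using vw assms(5) by (simp add: \<gamma> m_assoc inv_mult_group)
qed

text \<open>The subgroup is left arbitrary because the lemma serves twice: for the subgroup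
  generated by deltas and for centralisers of commutators.\<close>

lemma delta_move:
  assumes "subgroup T P" "commutes_bar v" "commutes_bar w" "commutes_bar (v @ w)" "commutes_bar (inv_word v @ w)" "z \<in> W"
    and "delta z \<in> T" "delta (v @ z) \<in> T" "delta (w @ z) \<in> T"
  shows "delta (v @ w @ z) \<in> T \<longleftrightarrow> delta (w @ v @ z) \<in> T"
proof -
  interpret T: subgroup T P by fact
  have vw: "v \<in> W" "w \<in> W"
    using assms commutes_bar_words by blast+
  define g where "g t = delta (t @ z) \<otimes> inv (delta z)" for t
  have g_T: "g t \<in> T \<longleftrightarrow> delta (t @ z) \<in> T" if "t \<in> W" for t
  proof
    assume "g t \<in> T"
    moreover have "delta (t @ z) = g t \<otimes> delta z"
      using that assms(6) by (simp add: g_def m_assoc)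
    ultimately show "delta (t @ z) \<in> T"
      using assms(7) by simp
  qed (use assms(7) in \<open>simp add: g_def\<close>)
  have closed: "g t \<in> carrier P" if "t \<in> W" for t
    using that assms(6) by (simp add: g_def)
  have vT: "g v \<in> T" and wT: "g w \<in> T"
    using assms g_T vw by simp_all
  have eq: "g (v @ w) = g w \<otimes> g v \<otimes> inv (g (w @ v)) \<otimes> g v \<otimes> g w"
    unfolding g_def using assms by (intro delta_move_eq)
  \<comment> \<open>Solving the identity for g(w v) gives one of the same shape with v and w
    exchanged, whence both directions of the equivalence.\<close>
  then have "g (w @ v) = g v \<otimes> g w \<otimes> inv (g (v @ w)) \<otimes> g w \<otimes> g v"
    using vw by (simp add: closed inv_mult_group m_assoc)
  with eq vT wT have "g (v @ w) \<in> T \<longleftrightarrow> g (w @ v) \<in> T"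
    by (metis T.m_closed T.m_inv_closed)
  then show ?thesis
    using vw by (simp add: g_T)
qed

text \<open>Membership for one sign and one side of the extra letter decides the other three:
  \<open>delta_flip\<close> changes the sign at the front, and \<open>delta_swap\<close> carries the
  letter to the other end.\<close>

lemma delta_letter_variants:
  assumes "subgroup T P" "incr ks" "symb c \<in> {1..m} - set ks"
    and "delta [c] \<in> T" "delta (mono ks) \<in> T" "delta (c # mono ks) \<in> T"
  shows "delta (inv_letter c # mono ks) \<in> T" "delta (mono ks @ [c]) \<in> T"
    "delta (mono ks @ [inv_letter c]) \<in> T"
proof -
  interpret T: subgroup T P by fact
  have c: "[c] \<in> W" and ks: "mono ks \<in> W"
    using assms by (auto simp: incr_words)
  have S: "commutes_bar [c]" "commutes_bar (mono ks)" "commutes_bar ([c] @ mono ks)" "commutes_bar (inv_letter c # mono ks)"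
    using assms by (auto intro: commutes_bar_letter commutes_bar_incr commutes_bar_left)
  have "delta (c # mono ks)
      = delta (mono ks) \<otimes> inv (delta (inv_letter c # mono ks)) \<otimes> delta (mono ks)"
    using delta_flip[OF S(1-3)] by simp
  then have "delta (inv_letter c # mono ks)
      = delta (mono ks) \<otimes> inv (delta (c # mono ks)) \<otimes> delta (mono ks)"
    using c ks by (simp add: inv_mult_group m_assoc)
  with assms show *: "delta (inv_letter c # mono ks) \<in> T"
    by simp
  have "delta (mono ks @ [c]) = delta [c] \<otimes> delta (inv_letter c # mono ks) \<otimes> delta [c]"
    using delta_swap[of "[c]" "mono ks"] c S by simp
  with assms * show "delta (mono ks @ [c]) \<in> T"
    by simp
  have "delta [inv_letter c] = inv (delta [c])"
    using delta_inv_word[OF S(1)] by simp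
  moreover have "delta (mono ks @ [inv_letter c])
      = delta [inv_letter c] \<otimes> delta (c # mono ks) \<otimes> delta [inv_letter c]"
    using delta_swap[of "[inv_letter c]" "mono ks"] c S by simp
  ultimately show "delta (mono ks @ [inv_letter c]) \<in> T"
    using assms by simp
qed

section \<open>The subgroup generated by the deltas of increasing monomials\<close>

definition delta_span :: "'a set" where
  "delta_span = generate P {delta (mono ks) | ks. incr ks}"

lemma subgroup_delta_span: "subgroup delta_span P"
  unfolding delta_span_def by (rule generate_is_subgroup) (auto simp: incr_words)

lemma delta_incr_delta_span: "incr ks \<Longrightarrow> delta (mono ks) \<in> delta_span"
  unfolding delta_span_def by (rule generate.incl) blast

lemma delta_letter_delta_span:
  assumes "symb c \<in> {1..m}"
  shows "delta [c] \<in> delta_span"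
proof -
  have c: "incr [symb c]"
    using assms by (simp add: incr_def)
  have S: "commutes_bar [Gen (symb c)]"
    using assms by (simp add: commutes_bar_letter)
  show ?thesis
    using delta_incr_delta_span[OF c] delta_inv_word[OF S] subgroup.m_inv_closed[OF subgroup_delta_span]
    by (cases c) auto
qed

text \<open>At its sorted position the new letter gives an increasing monomial, whose delta is a
  generator; \<open>delta_move\<close> then brings the letter to the front past the smaller
  ones.\<close>

lemma delta_new_letter_delta_span:
  assumes "incr ks" "symb c \<in> {1..m} - set ks"
  shows "delta (c # mono ks) \<in> delta_span" "delta (mono ks @ [c]) \<in> delta_span"
proof -
  define k where "k = symb c"
  have k: "k \<in> {1..m}" "k \<notin> set ks"
    using assms by (auto simp: k_def)
  then obtain as bs where ks: "ks = as @ bs" and abs: "incr (as @ k # bs)"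
    using incr_insert assms(1) by blast
  note abs' = incr_removeD[OF abs]
  have "delta (mono as @ [Gen k] @ mono bs) \<in> delta_span \<longleftrightarrow> delta ([Gen k] @ mono as @ mono bs) \<in> delta_span"
    using abs' delta_incr_delta_span[OF abs'(2)] delta_incr_delta_span[OF abs'(3)] delta_incr_delta_span[OF abs'(4)]
    by (intro delta_move subgroup_delta_span commutes_bar_incr commutes_bar_letter commutes_bar_right commutes_bar_quotient incr_words) auto
  then have *: "delta (Gen k # mono ks) \<in> delta_span"
    using delta_incr_delta_span[OF abs] by (simp add: ks)
  moreover have "delta [Gen k] \<in> delta_span"
    using k by (simp add: delta_letter_delta_span)
  moreover have "symb (Gen k) \<in> {1..m} - set ks"
    using k by simp
  ultimately have "delta (inv_letter (Gen k) # mono ks) \<in> delta_span" "delta (mono ks @ [Gen k]) \<in> delta_span"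
    "delta (mono ks @ [inv_letter (Gen k)]) \<in> delta_span"
    using delta_letter_variants[OF subgroup_delta_span assms(1)] delta_incr_delta_span[OF assms(1)] by blast+
  with * show "delta (c # mono ks) \<in> delta_span" "delta (mono ks @ [c]) \<in> delta_span"
    by (cases c; simp add: k_def)+
qed

text \<open>The case in which the appended letter has the symbol of the leading letter. It is the
  target of \<open>delta_snoc_delta_span\<close>, which moves a repeated symbol to the
  front.\<close>

lemma delta_first_letter_delta_span:
  assumes "incr ks" "k \<in> {1..m} - set ks" "symb c = k"
  shows "delta (Gen k # mono ks @ [c]) \<in> delta_span"
proof -
  interpret M: subgroup delta_span P by (rule subgroup_delta_span)
  have ks: "mono ks \<in> W" and k: "[Gen k] \<in> W" "[GenInv k] \<in> W"
    using assms by (auto simp: incr_words)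
  have S: "commutes_bar [Gen k]" "commutes_bar (mono ks)" "commutes_bar ([Gen k] @ mono ks)" "commutes_bar ([GenInv k] @ mono ks)"
    using assms by (auto intro!: commutes_bar_letter commutes_bar_incr commutes_bar_left)
  have T: "delta [Gen k] \<in> delta_span" "delta [GenInv k] \<in> delta_span" "delta (mono ks) \<in> delta_span"
      "delta (mono ks @ [c]) \<in> delta_span" "delta [c] \<in> delta_span"
    using assms delta_letter_delta_span delta_incr_delta_span delta_new_letter_delta_span by auto
  show ?thesis
  proof (cases c)
    case (Gen i)
    then have c: "c = Gen k"
      using assms by simp
    have "delta (([Gen k] @ mono ks) @ [Gen k])
        = inv (u [Gen k]) \<otimes> delta ([Gen k] @ mono ks) \<otimes> u [Gen k] \<otimes> delta [Gen k]"
      using k ks by (intro delta_append) auto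
    also have "\<dots> = delta [Gen k] \<otimes> delta (mono ks) \<otimes> delta [Gen k]"
      using delta_conj_prefix[OF k(1) S(2,3)] by simp
    finally show ?thesis
      using T by (simp add: c)
  next
    case (GenInv i)
    then have c: "c = GenInv k"
      using assms by simp
    have "inv (u [GenInv k]) \<otimes> delta ([GenInv k] @ mono ks) \<otimes> u [GenInv k]
        = delta [GenInv k] \<otimes> delta (mono ks)"
      using delta_conj_prefix[OF k(2) S(2,4)] .
    then have 1: "inv (inv (u [GenInv k]) \<otimes> delta ([GenInv k] @ mono ks) \<otimes> u [GenInv k]) \<in> delta_span"
      using T by simp
    have 2: "inv (u [GenInv k]) \<otimes> delta (mono ks) \<otimes> u [GenInv k] \<in> delta_span"
      using delta_conj[OF ks k(2)] T by (simp add: c)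
    \<comment> \<open>Conjugating by the value of \<open>[GenInv k]\<close> shortens only words that
      begin with \<open>GenInv k\<close>, so the sign of the leading letter is flipped before
      conjugating.\<close>
    have "delta ([Gen k] @ mono ks)
        = delta (mono ks) \<otimes> inv (delta ([GenInv k] @ mono ks)) \<otimes> delta (mono ks)"
      using delta_flip[OF S(1-3)] by simp
    moreover have "delta (([Gen k] @ mono ks) @ [GenInv k])
        = inv (u [GenInv k]) \<otimes> delta ([Gen k] @ mono ks) \<otimes> u [GenInv k] \<otimes> delta [GenInv k]"
      using k ks by (intro delta_append) auto
    ultimately have "delta (([Gen k] @ mono ks) @ [GenInv k])
        = (inv (u [GenInv k]) \<otimes> delta (mono ks) \<otimes> u [GenInv k])
          \<otimes> inv (inv (u [GenInv k]) \<otimes> delta ([GenInv k] @ mono ks) \<otimes> u [GenInv k])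
          \<otimes> (inv (u [GenInv k]) \<otimes> delta (mono ks) \<otimes> u [GenInv k]) \<otimes> delta [GenInv k]"
      using k ks delta_closed[of "[GenInv k] @ mono ks"] u_closed[OF k(2)]
      by (simp add: inv_mult_group m_assoc)
    with 1 2 T have "delta (([Gen k] @ mono ks) @ [GenInv k]) \<in> delta_span"
      by (simp only: M.m_closed)
    then show ?thesis
      by (simp add: c)
  qed
qed

text \<open>If the symbol of c already occurs, that occurrence is moved to the front, with the tail
  z containing c. The side conditions then concern words in which c is a new letter or matches the
  leading letter.\<close>

lemma delta_snoc_delta_span:
  assumes "incr ks" "symb c \<in> {1..m}"
  shows "delta (mono ks @ [c]) \<in> delta_span"
proof (cases "symb c \<in> set ks")
  case True
  define k where "k = symb c"
  obtain as bs where ks: "ks = as @ k # bs"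
    using True by (auto simp: k_def in_set_conv_decomp)
  have abs: "incr (as @ k # bs)"
    using assms ks by simp
  note abs' = incr_removeD[OF abs]
  have "delta (mono bs @ [c]) \<in> delta_span" "delta (mono (as @ bs) @ [c]) \<in> delta_span"
    by (rule delta_new_letter_delta_span; use abs' in \<open>simp add: k_def\<close>)+
  moreover have "delta (Gen k # mono bs @ [c]) \<in> delta_span" "delta (Gen k # mono (as @ bs) @ [c]) \<in> delta_span"
    by (rule delta_first_letter_delta_span; use abs' in \<open>simp add: k_def\<close>)+
  ultimately have new: "delta (mono bs @ [c]) \<in> delta_span" "delta (mono as @ mono bs @ [c]) \<in> delta_span"
    "delta (Gen k # mono bs @ [c]) \<in> delta_span" "delta (Gen k # mono as @ mono bs @ [c]) \<in> delta_span"
    by simp_all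
  have "delta (mono as @ [Gen k] @ mono bs @ [c]) \<in> delta_span
      \<longleftrightarrow> delta ([Gen k] @ mono as @ mono bs @ [c]) \<in> delta_span"
    using abs' new assms(2)
    by (intro delta_move subgroup_delta_span commutes_bar_incr commutes_bar_letter commutes_bar_right commutes_bar_quotient) (auto simp: incr_words)
  with new show ?thesis
    by (simp add: ks)
qed (use assms delta_new_letter_delta_span in auto)

text \<open>On a generator the conjugate is delta(ks c) delta(c)^-1, so this is the purpose of the
  preceding closure lemma. The letter c may have either sign, hence conjugation by inverses is
  covered as well.\<close>

lemma conj_letter_delta_span:
  assumes "g \<in> delta_span" "symb c \<in> {1..m}"
  shows "inv (u [c]) \<otimes> g \<otimes> u [c] \<in> delta_span"
  using assms(1)[unfolded delta_span_def]
proof (induction rule: generate.induct)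
  case one
  then show ?case
    using assms(2) subgroup.one_closed[OF subgroup_delta_span] u_closed[of "[c]"] by simp
next
  case (incl h)
  then show ?case
    using assms(2) subgroup_delta_span
    by (auto simp: delta_conj incr_words delta_snoc_delta_span delta_letter_delta_span subgroup.m_closed subgroup.m_inv_closed)
next
  case (inv h)
  then obtain ks where ks: "incr ks" "h = delta (mono ks)"
    by blast
  have "inv (inv (u [c]) \<otimes> h \<otimes> u [c]) \<in> delta_span"
    using assms(2) subgroup_delta_span ks
    by (auto simp: delta_conj incr_words delta_snoc_delta_span delta_letter_delta_span subgroup.m_closed subgroup.m_inv_closed)
  then show ?case
    using assms(2) ks u_closed[of "[c]"] by (simp add: inv_mult_group m_assoc incr_words)
next
  case (eng h1 h2)
  have "h1 \<in> carrier P" "h2 \<in> carrier P"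
    using eng(1,2) subgroup.subset[OF subgroup_delta_span] unfolding delta_span_def by blast+
  then have "inv (u [c]) \<otimes> (h1 \<otimes> h2) \<otimes> u [c]
      = (inv (u [c]) \<otimes> h1 \<otimes> u [c]) \<otimes> (inv (u [c]) \<otimes> h2 \<otimes> u [c])"
    using assms(2) u_closed[of "[c]"] by (simp add: m_assoc)
  then show ?case
    using eng subgroup.m_closed[OF subgroup_delta_span] by simp
qed

lemma delta_in_delta_span:
  assumes "w \<in> W"
  shows "delta w \<in> delta_span"
  using assms
proof (induction w rule: rev_induct)
  case Nil
  then show ?case
    using subgroup.one_closed[OF subgroup_delta_span] by simp
next
  case (snoc c w)
  then show ?case
    by (simp add: delta_append conj_letter_delta_span delta_letter_delta_span subgroup.m_closed[OF subgroup_delta_span])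
qed

section \<open>The exchange identity for commutators\<close>

definition swappable :: "nat word \<Rightarrow> nat word \<Rightarrow> bool" where
  "swappable v w \<longleftrightarrow> commutator P (u v) (b w) = commutator P (b v) (u w)"

text \<open>Multiplying either commutator on the left by u(v) b(v) = b(v) u(v) and on the right by
  the inverse of u(w) b(w) = b(w) u(w) yields the two products of u(v w^-1) and b(v w^-1), in
  opposite orders.\<close>

lemma swappable_iff_commutes_bar:
  assumes "commutes_bar v" "commutes_bar w"
  shows "swappable v w \<longleftrightarrow> commutes_bar (v @ inv_word w)"
proof -
  have vw: "v \<in> W" "w \<in> W"
    using assms commutes_bar_words by blast+
  define l r where "l = commutator P (u v) (b w)" and "r = commutator P (b v) (u w)"
  have lr: "l \<in> carrier P" "r \<in> carrier P"
    using vw by (simp_all add: l_def r_def)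
  have l: "(b v \<otimes> u v) \<otimes> l \<otimes> (inv (b w) \<otimes> inv (u w))
      = (b v \<otimes> inv (b w)) \<otimes> (u v \<otimes> inv (u w))"
    using vw by (simp add: l_def commutator_def m_assoc)
  have r: "(u v \<otimes> b v) \<otimes> r \<otimes> (inv (u w) \<otimes> inv (b w))
      = (u v \<otimes> inv (u w)) \<otimes> (b v \<otimes> inv (b w))"
    using vw by (simp add: r_def commutator_def m_assoc)
  have "inv (u w) \<otimes> inv (b w) = inv (b w) \<otimes> inv (u w)"
    using assms(2) vw by (simp add: commutes_bar_def flip: inv_mult_group)
  with r have "(b v \<otimes> u v) \<otimes> r \<otimes> (inv (b w) \<otimes> inv (u w))
      = (u v \<otimes> inv (u w)) \<otimes> (b v \<otimes> inv (b w))"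
    using commutes_bar_commute[OF assms(1)] by simp
  with l have "(u v \<otimes> inv (u w)) \<otimes> (b v \<otimes> inv (b w)) = (b v \<otimes> inv (b w)) \<otimes> (u v \<otimes> inv (u w))
      \<longleftrightarrow> (b v \<otimes> u v) \<otimes> r \<otimes> (inv (b w) \<otimes> inv (u w))
        = (b v \<otimes> u v) \<otimes> l \<otimes> (inv (b w) \<otimes> inv (u w))"
    by simp
  also have "\<dots> \<longleftrightarrow> r = l"
    using lr vw by simp
  finally have "l = r \<longleftrightarrow> (u v \<otimes> inv (u w)) \<otimes> (b v \<otimes> inv (b w))
      = (b v \<otimes> inv (b w)) \<otimes> (u v \<otimes> inv (u w))"
    by blast
  then show ?thesis
    using vw by (auto simp: swappable_def commutes_bar_def l_def r_def)
qed

abbreviation comm :: "nat word \<Rightarrow> nat word \<Rightarrow> 'a" where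
  "comm v w \<equiv> commutator P (u v) (b w)"

lemma comm_closed: "v \<in> W \<Longrightarrow> w \<in> W \<Longrightarrow> comm v w \<in> carrier P"
  by simp

text \<open>Expanding both commutators by \<open>commutator_mult_left\<close> leaves the conjugates
  of the same element by u(w) and by b(w). They agree iff that element commutes with b(w) u(w)^-1,
  which is delta(w). This is where exchange becomes a centraliser condition.\<close>

lemma swappable_append_iff:
  assumes "v \<in> W" "commutes_bar w" "z \<in> W" "swappable v z" "swappable w z"
  shows "swappable (v @ w) z \<longleftrightarrow> comm v z \<in> centralizer (delta w)"
proof -
  have w: "w \<in> W"
    using assms(2) by (rule commutes_bar_words)
  define d where "d = comm v z"
  have d: "d \<in> carrier P"
    using assms by (simp add: d_def)
  have "commutator P (u (v @ w)) (b z) = inv (u w) \<otimes> d \<otimes> u w \<otimes> comm w z"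
    using assms w by (simp add: d_def commutator_mult_left)
  moreover have "commutator P (b (v @ w)) (u z) = inv (b w) \<otimes> d \<otimes> b w \<otimes> comm w z"
    using assms w by (simp add: d_def commutator_mult_left swappable_def)
  ultimately have "swappable (v @ w) z \<longleftrightarrow>
      inv (u w) \<otimes> d \<otimes> u w = inv (b w) \<otimes> d \<otimes> b w"
    using assms w d by (simp add: swappable_def)
  also have "\<dots> \<longleftrightarrow> b w \<otimes> (inv (u w) \<otimes> d \<otimes> u w) \<otimes> inv (u w) = b w \<otimes> (inv (b w) \<otimes> d \<otimes> b w) \<otimes> inv (u w)"
    using w d by simp
  also have "\<dots> \<longleftrightarrow> delta w \<otimes> d = d \<otimes> delta w"
    using w d by (simp add: delta_commutes_bar[OF assms(2)] m_assoc)
  finally show ?thesis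
    using d by (auto simp: centralizer_def d_def)
qed


lemma swappable_sym:
  assumes "v \<in> W" "w \<in> W" "swappable v w"
  shows "swappable w v" "comm w v = inv (comm v w)"
proof -
  have "inv (commutator P (u v) (b w)) = inv (commutator P (b v) (u w))"
    using assms by (simp add: swappable_def)
  then have "commutator P (b w) (u v) = commutator P (u w) (b v)"
    using assms by (simp add: inv_commutator)
  then show "swappable w v" "comm w v = inv (comm v w)"
    using assms by (simp_all add: swappable_def inv_commutator)
qed

lemma comm_same_letter:
  assumes "symb p \<in> {1..m}" "symb q = symb p"
  shows "comm [p] [q] = \<one>" "swappable [p] [q]"
proof -
  have c: "u [p] \<otimes> b [p] = b [p] \<otimes> u [p]" "u [p] \<in> carrier P" "b [p] \<in> carrier P"
    using assms commutes_bar_commute[OF commutes_bar_letter, of p] by simp_all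
  have "q = p \<or> q = inv_letter p"
    using assms by (cases p; cases q) auto
  then have "u [p] \<otimes> b [q] = b [q] \<otimes> u [p]" "b [p] \<otimes> u [q] = u [q] \<otimes> b [p]"
    using c assms commute_inv_left[of "b [p]" "u [p]"] commute_inv_left[of "u [p]" "b [p]"] by auto
  then have "comm [p] [q] = \<one>" "commutator P (b [p]) (u [q]) = \<one>"
    using assms by (simp_all add: commutator_eq_one_iff)
  then show "comm [p] [q] = \<one>" "swappable [p] [q]"
    by (simp_all add: swappable_def)
qed

lemma swappable_letters:
  assumes "symb p \<in> {1..m}" "symb q \<in> {1..m}"
  shows "swappable [p] [q]"
proof (cases "symb p = symb q")
  case False
  then have "commutes_bar ([p] @ inv_word [q])"
    using assms commutes_bar_pair[of p "inv_letter q"] by simp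
  then show ?thesis
    using swappable_iff_commutes_bar[OF commutes_bar_letter commutes_bar_letter] assms by simp
qed (use assms comm_same_letter in simp)

lemma mem_centralizer_sym:
  assumes "g \<in> carrier P" "h \<in> carrier P"
  shows "g \<in> centralizer h \<longleftrightarrow> h \<in> centralizer g"
  using assms by (auto simp: centralizer_def)

text \<open>Under the exchange identity, interchanging the arguments inverts the commutator, and an
  element and its inverse have the same centraliser.\<close>

lemma comm_centralizer_sym:
  assumes "v \<in> W" "w \<in> W" "swappable v w" "g \<in> carrier P"
  shows "g \<in> centralizer (comm w v) \<longleftrightarrow> g \<in> centralizer (comm v w)"
proof -
  have "inv d \<in> centralizer g" if "d \<in> centralizer g" for d
    using subgroup.m_inv_closed[OF subgroup_centralizer] that assms by blast
  moreover have "comm v w = inv (comm w v)"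
    using swappable_sym[OF assms(1-3)] assms by simp
  ultimately show ?thesis
    using assms swappable_sym(2)[OF assms(1-3)] mem_centralizer_sym comm_closed by metis
qed

lemma centralizer_conj:
  assumes "g \<in> carrier P" "h \<in> carrier P" "k \<in> centralizer h"
  shows "inv g \<otimes> k \<otimes> g \<in> centralizer (inv g \<otimes> h \<otimes> g)"
proof -
  have "k \<in> carrier P" "k \<otimes> h = h \<otimes> k"
    using assms(3) by (auto simp: centralizer_def)
  then have "k \<otimes> (h \<otimes> g) = h \<otimes> (k \<otimes> g)"
    using assms by (simp flip: m_assoc)
  with \<open>k \<in> carrier P\<close> show ?thesis
    using assms by (simp add: centralizer_def m_assoc)
qed

lemma comm_inv_letter:
  assumes "symb p \<in> {1..m}" "symb q \<in> {1..m}"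
  shows "comm [p] [q] = inv (u [p]) \<otimes> inv (comm [inv_letter p] [q]) \<otimes> u [p]"
proof -
  show ?thesis
    using assms by (simp add: commutator_def inv_mult_group m_assoc)
qed

section \<open>Deltas centralise the commutators of letters\<close>

lemma delta_letter_centralizer:
  assumes "symb p \<in> {1..m}" "symb q \<in> {1..m}"
  shows "delta [p] \<in> centralizer (comm [p] [q])" "delta [q] \<in> centralizer (comm [p] [q])"
proof -
  have *: "delta [p] \<in> centralizer (comm [p] [q])"
    if "symb p \<in> {1..m}" "symb q \<in> {1..m}" for p q
  proof -
    have pq: "[p] \<in> W" "[inv_letter p] \<in> W" "[q] \<in> W" "commutes_bar [inv_letter p]"
      using that commutes_bar_letter by auto
    \<comment> \<open>Both values of p p^-1 are trivial, so it satisfies the exchange identity with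
      every word; the criterion for an appended letter then gives the claim for p^-1.\<close>
    have "u ([p] @ inv_word [p]) = \<one>" "b ([p] @ inv_word [p]) = \<one>"
      using that by (simp_all only: u_append u_inv_word b_append b_inv_word u_closed b_closed
          words_Cons words_Nil words_inv_word r_inv simp_thms)
    then have "swappable ([p] @ [inv_letter p]) [q]"
      using pq u_closed[of "[q]"] b_closed[of "[q]"]
      by (simp add: swappable_def commutator_def)
    then have "comm [p] [q] \<in> centralizer (delta [inv_letter p])"
      using swappable_append_iff[OF pq(1,4,3)] swappable_letters that by simp
    then have "delta [inv_letter p] \<in> centralizer (comm [p] [q])"
      using pq mem_centralizer_sym comm_closed delta_closed by blast
    moreover have "delta [p] = inv (delta [inv_letter p])"
      using delta_inv_word[of "[p]"] commutes_bar_letter that delta_closed[OF pq(1)] by simp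
    ultimately show ?thesis
      using subgroup.m_inv_closed[OF subgroup_centralizer] comm_closed[OF pq(1,3)] by metis
  qed
  show "delta [p] \<in> centralizer (comm [p] [q])"
    using * assms by blast
  have "delta [q] \<in> centralizer (comm [q] [p])"
    using * assms by blast
  then show "delta [q] \<in> centralizer (comm [p] [q])"
    using comm_centralizer_sym[of "[p]" "[q]"] swappable_letters assms delta_closed[of "[q]"] by simp
qed

text \<open>The only use of the full relators beta_0 w_0 alpha_0 in the centralising argument: they
  give the exchange identity for (p ks, q), and comparison with that for (ks, q) through
  \<open>swappable_append_iff\<close> yields the claim.\<close>

lemma delta_avoid_centralizer:
  assumes "incr ks" "symb p \<in> {1..m} - set ks" "symb q \<in> {1..m} - set ks" "symb p \<noteq> symb q"
  shows "delta (mono ks) \<in> centralizer (comm [p] [q])"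
proof (cases "ks = []")
  case True
  then show ?thesis
    using assms comm_closed[of "[p]" "[q]"] subgroup.one_closed[OF subgroup_centralizer] by simp
next
  case False
  have W: "[p] \<in> W" "[q] \<in> W" "mono ks \<in> W"
    using assms by auto
  have S: "commutes_bar [q]" "commutes_bar (mono ks)" "commutes_bar ([p] @ mono ks)"
    using assms by (auto intro: commutes_bar_letter commutes_bar_incr commutes_bar_left)
  \<comment> \<open>The letter is inverted because the exchange identity corresponds to commutation
    on v w^-1.\<close>
  have "commutes_bar (mono ks @ [inv_letter q])" "commutes_bar (([p] @ mono ks) @ [inv_letter q])"
    using assms False by (auto intro: commutes_bar_right commutes_bar_both)
  then have "swappable (mono ks) [q]" "swappable ([p] @ mono ks) [q]"
    using swappable_iff_commutes_bar[OF S(2) S(1)] swappable_iff_commutes_bar[OF S(3) S(1)] by simp_all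
  then have "comm [p] [q] \<in> centralizer (delta (mono ks))"
    using swappable_append_iff[OF W(1) S(2) W(2)] swappable_letters assms by simp
  then show ?thesis
    using W mem_centralizer_sym comm_closed delta_closed by blast
qed

text \<open>Conjugation by u(p) sends delta(p^-1) delta(ks) to delta(p^-1 ks) and the inverse of the
  commutator for p^-1 to the commutator for p. Hence both signs of p are needed in the hypotheses.
  The word p ks then follows from p^-1 ks by \<open>delta_letter_variants\<close>.\<close>

lemma delta_cons_centralizer:
  assumes "incr ks" "symb p \<in> {1..m} - set ks" "symb q \<in> {1..m}"
    and "delta (mono ks) \<in> centralizer (comm [p] [q])"
    and "delta (mono ks) \<in> centralizer (comm [inv_letter p] [q])"
  shows "delta (p # mono ks) \<in> centralizer (comm [p] [q])"
    "delta (inv_letter p # mono ks) \<in> centralizer (comm [p] [q])"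
proof -
  define p' where "p' = inv_letter p"
  have W: "[p] \<in> W" "[q] \<in> W" "mono ks \<in> W" "[p'] \<in> W" and p': "symb p' \<in> {1..m} - set ks"
    using assms by (auto simp: p'_def)
  note up = u_closed[OF W(1)]
  interpret C: subgroup "centralizer (comm [p'] [q])" P
    using W by (intro subgroup_centralizer comm_closed)
  have sub: "subgroup (centralizer (comm [p] [q])) P"
    using W by (intro subgroup_centralizer comm_closed)
  have u': "u [p'] = inv (u [p])"
    using assms by (simp add: p'_def)
  have "inv (u [p']) \<otimes> delta ([p'] @ mono ks) \<otimes> u [p'] = delta [p'] \<otimes> delta (mono ks)"
    using assms p' W by (intro delta_conj_prefix commutes_bar_incr) (auto intro: commutes_bar_left)
  then have "u [p] \<otimes> delta ([p'] @ mono ks) \<otimes> inv (u [p]) = delta [p'] \<otimes> delta (mono ks)"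
    using up by (simp add: u')
  then have "inv (u [p]) \<otimes> (delta [p'] \<otimes> delta (mono ks)) \<otimes> u [p]
      = inv (u [p]) \<otimes> (u [p] \<otimes> delta ([p'] @ mono ks) \<otimes> inv (u [p])) \<otimes> u [p]"
    by simp
  also have "\<dots> = delta ([p'] @ mono ks)"
    using up delta_closed[of "[p'] @ mono ks"] W by (simp add: m_assoc)
  finally have "delta ([p'] @ mono ks) = inv (u [p]) \<otimes> (delta [p'] \<otimes> delta (mono ks)) \<otimes> u [p]" ..
  moreover have "delta [p'] \<otimes> delta (mono ks) \<in> centralizer (comm [p'] [q])"
    using delta_letter_centralizer(1)[of p' q] assms(3,5) p' unfolding p'_def
    by (intro C.m_closed[unfolded p'_def]) auto
  then have "delta [p'] \<otimes> delta (mono ks) \<in> centralizer (inv (comm [p'] [q]))"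
  proof -
    assume "delta [p'] \<otimes> delta (mono ks) \<in> centralizer (comm [p'] [q])"
    then have "comm [p'] [q] \<in> centralizer (delta [p'] \<otimes> delta (mono ks))"
      using W mem_centralizer_sym comm_closed by simp
    then have "inv (comm [p'] [q]) \<in> centralizer (delta [p'] \<otimes> delta (mono ks))"
      using W subgroup.m_inv_closed[OF subgroup_centralizer] by simp
    then show ?thesis
      using W mem_centralizer_sym comm_closed by simp
  qed
  moreover have "comm [p] [q] = inv (u [p]) \<otimes> inv (comm [p'] [q]) \<otimes> u [p]"
    using comm_inv_letter assms by (simp add: p'_def)
  ultimately have *: "delta (p' # mono ks) \<in> centralizer (comm [p] [q])"
    using centralizer_conj[OF up, of "inv (comm [p'] [q])"] W comm_closed[of "[p']" "[q]"] by simp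
  have "delta [p'] \<in> centralizer (comm [p] [q])"
    using delta_letter_centralizer(1)[of p q] assms delta_inv_word[of "[p]"] commutes_bar_letter[of p]
      subgroup.m_inv_closed[OF sub] by (simp add: p'_def)
  with * have "delta (inv_letter p' # mono ks) \<in> centralizer (comm [p] [q])"
    using delta_letter_variants(1)[OF sub assms(1), of p'] p' assms by blast
  with * show "delta (p # mono ks) \<in> centralizer (comm [p] [q])"
    "delta (inv_letter p # mono ks) \<in> centralizer (comm [p] [q])"
    by (simp_all add: p'_def)
qed

text \<open>Allows the monomial to contain the symbol of p: the letter at the front is handled by
  \<open>delta_cons_centralizer\<close> and is then moved to its sorted place. The premise
  \<open>avoid\<close> ranges over all sublists met on the way and over both signs of p.\<close>

lemma delta_insert_centralizer:
  assumes "incr (as @ k # bs)" "symb p = k" "symb q \<in> {1..m}"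
    and avoid: "\<And>ks p. incr ks \<Longrightarrow> set ks \<subseteq> set as \<union> set bs \<Longrightarrow> symb p = k \<Longrightarrow>
      delta (mono ks) \<in> centralizer (comm [p] [q])"
  shows "delta (mono (as @ k # bs)) \<in> centralizer (comm [p] [q])"
proof -
  note abs = incr_removeD[OF assms(1)]
  let ?T = "centralizer (comm [p] [q])"
  have sub: "subgroup ?T P"
    using assms abs by (intro subgroup_centralizer comm_closed) auto
  have cons: "delta (Gen k # mono ks) \<in> ?T" if "incr ks" "set ks \<subseteq> set as \<union> set bs" for ks
  proof -
    have "symb p \<in> {1..m} - set ks"
      using that abs assms by auto
    moreover have "delta (mono ks) \<in> ?T" "delta (mono ks) \<in> centralizer (comm [inv_letter p] [q])"
      using that assms by (auto intro!: avoid simp del: u_inv_letter)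
    ultimately have "delta (p # mono ks) \<in> ?T" "delta (inv_letter p # mono ks) \<in> ?T"
      using delta_cons_centralizer[OF that(1) _ assms(3)] by blast+
    then show ?thesis
      using assms(2) by (cases p) auto
  qed
  have "delta (mono as @ [Gen k] @ mono bs) \<in> ?T \<longleftrightarrow> delta ([Gen k] @ mono as @ mono bs) \<in> ?T"
    using abs assms(2) avoid[of bs] avoid[of "as @ bs"] cons[of bs]
    by (intro delta_move sub commutes_bar_incr commutes_bar_letter commutes_bar_right commutes_bar_quotient incr_words) auto
  moreover have "delta (Gen k # mono (as @ bs)) \<in> ?T"
    using abs by (intro cons) auto
  ultimately show ?thesis
    by simp
qed

lemma delta_avoid_right_centralizer:
  assumes "incr ks" "symb p \<in> {1..m}" "symb q \<in> {1..m} - set ks" "symb p \<noteq> symb q"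
  shows "delta (mono ks) \<in> centralizer (comm [p] [q])"
proof (cases "symb p \<in> set ks")
  case True
  then obtain as bs where ks: "ks = as @ symb p # bs"
    by (auto simp: in_set_conv_decomp)
  note abs = incr_removeD[OF assms(1)[unfolded ks]]
  show ?thesis
    unfolding ks using assms abs
    by (intro delta_insert_centralizer delta_avoid_centralizer) (auto simp: ks)
qed (use assms delta_avoid_centralizer in auto)

lemma delta_avoid_left_centralizer:
  assumes "incr ks" "symb p \<in> {1..m} - set ks" "symb q \<in> {1..m}" "symb p \<noteq> symb q"
  shows "delta (mono ks) \<in> centralizer (comm [p] [q])"
  using delta_avoid_right_centralizer[of ks q p] comm_centralizer_sym[of "[p]" "[q]" "delta (mono ks)"]
    swappable_letters[of p q] assms by auto

lemma delta_incr_centralizer: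
  assumes "incr ks" "symb p \<in> {1..m}" "symb q \<in> {1..m}" "symb p \<noteq> symb q"
  shows "delta (mono ks) \<in> centralizer (comm [p] [q])"
proof (cases "symb p \<in> set ks")
  case True
  then obtain as bs where ks: "ks = as @ symb p # bs"
    by (auto simp: in_set_conv_decomp)
  note abs = incr_removeD[OF assms(1)[unfolded ks]]
  show ?thesis
    unfolding ks using assms abs
    by (intro delta_insert_centralizer delta_avoid_left_centralizer) (auto simp: ks)
qed (use assms delta_avoid_left_centralizer in auto)

lemma delta_centralizer:
  assumes "symb p \<in> {1..m}" "symb q \<in> {1..m}" "w \<in> W"
  shows "delta w \<in> centralizer (comm [p] [q])"
proof (cases "symb p = symb q")
  case True
  then show ?thesis
    using assms by (simp add: comm_same_letter centralizer_def)
next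
  case False
  have "delta_span \<subseteq> centralizer (comm [p] [q])"
    unfolding delta_span_def using False assms
    by (intro generate_subgroup_incl subgroup_centralizer comm_closed) (auto intro: delta_incr_centralizer)
  then show ?thesis
    using delta_in_delta_span assms by blast
qed

section \<open>Elements centralising all deltas, and commutation on every word\<close>

definition delta_commutant :: "'a set" where
  "delta_commutant = {z \<in> carrier P. \<forall>w\<in>W. z \<in> centralizer (delta w)}"

lemma subgroup_delta_commutant: "subgroup delta_commutant P"
proof -
  note c = subgroup_centralizer[OF delta_closed]
  show ?thesis
    by (rule subgroupI)
      (auto simp: delta_commutant_def intro: subgroup.m_closed[OF c] subgroup.m_inv_closed[OF c] subgroup.one_closed[OF c])
qed

text \<open>Conjugating back, the claim says that z commutes with u(c) delta(w) u(c)^-1, and by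
  \<open>delta_conj\<close> this element is a product of a delta and the inverse of a delta.\<close>

lemma conj_letter_delta_commutant:
  assumes "z \<in> delta_commutant" "symb c \<in> {1..m}"
  shows "inv (u [c]) \<otimes> z \<otimes> u [c] \<in> delta_commutant"
proof -
  have z: "z \<in> carrier P" and uc: "u [c] \<in> carrier P" and c: "[inv_letter c] \<in> W"
    using assms u_closed[of "[c]"] by (auto simp: delta_commutant_def)
  have u': "u [inv_letter c] = inv (u [c])"
    using assms by simp
  interpret C: subgroup "centralizer z" P
    using z by (rule subgroup_centralizer)
  have zC: "delta v \<in> centralizer z" if "v \<in> W" for v
    using assms that z mem_centralizer_sym delta_closed by (auto simp: delta_commutant_def)
  have "inv (u [c]) \<otimes> z \<otimes> u [c] \<in> centralizer (delta w)" if w: "w \<in> W" for w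
  proof -
    define h where "h = u [c] \<otimes> delta w \<otimes> inv (u [c])"
    have "inv (u [inv_letter c]) \<otimes> delta w \<otimes> u [inv_letter c]
        = delta (w @ [inv_letter c]) \<otimes> inv (delta [inv_letter c])"
      using w c by (rule delta_conj)
    then have "h = delta (w @ [inv_letter c]) \<otimes> inv (delta [inv_letter c])"
      using uc by (simp add: h_def u')
    then have "h \<in> centralizer z"
      using zC w c by simp
    then have "z \<in> centralizer h"
      using z mem_centralizer_sym C.mem_carrier by blast
    then have "inv (u [c]) \<otimes> z \<otimes> u [c] \<in> centralizer (inv (u [c]) \<otimes> h \<otimes> u [c])"
      using w uc by (intro centralizer_conj) (simp_all add: h_def)
    then show ?thesis
      using w uc by (simp add: h_def m_assoc)
  qed
  then show ?thesis
    using z uc by (simp add: delta_commutant_def)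
qed

text \<open>The exchange identity alone does not carry the induction: appending a letter e requires
  the commutator reached so far to centralise delta(e), so membership in
  \<open>delta_commutant\<close> is carried along.\<close>

lemma swappable_letter:
  assumes "w \<in> W" "symb c \<in> {1..m}"
  shows "swappable w [c] \<and> comm w [c] \<in> delta_commutant"
  using assms(1)
proof (induction w rule: rev_induct)
  case Nil
  show ?case
    using assms(2) u_closed[of "[c]"] b_closed[of "[c]"] subgroup.one_closed[OF subgroup_delta_commutant]
    by (simp add: swappable_def commutator_def)
next
  case (snoc e w)
  then have e: "w \<in> W" "symb e \<in> {1..m}" "[e] \<in> W" "[c] \<in> W"
    using assms(2) by auto
  with snoc.IH have IH: "swappable w [c]" "comm w [c] \<in> delta_commutant"
    by auto
  have "comm (w @ [e]) [c] = inv (u [e]) \<otimes> comm w [c] \<otimes> u [e] \<otimes> comm [e] [c]"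
    using e by (simp add: commutator_mult_left)
  moreover have "comm [e] [c] \<in> delta_commutant"
    using e assms(2) delta_centralizer mem_centralizer_sym comm_closed delta_closed
    by (auto simp: delta_commutant_def)
  ultimately have "comm (w @ [e]) [c] \<in> delta_commutant"
    using IH e subgroup.m_closed[OF subgroup_delta_commutant] conj_letter_delta_commutant by (simp)
  moreover have "swappable (w @ [e]) [c]"
    using e IH swappable_letters[of e c] assms(2) swappable_append_iff[of w "[e]" "[c]"] commutes_bar_letter[of e]
    by (auto simp: delta_commutant_def)
  ultimately show ?case
    by blast
qed

lemma commutes_bar_all:
  assumes "w \<in> W"
  shows "commutes_bar w"
  using assms
proof (induction w rule: rev_induct)
  case Nil
  show ?case by (rule commutes_bar_Nil)
next
  case (snoc c w)
  \<comment> \<open>With the inverse letter as second argument, the quotient in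
    \<open>swappable_iff_commutes_bar\<close> becomes w followed by c.\<close>
  then have "commutes_bar w" "commutes_bar [inv_letter c]" "swappable w [inv_letter c]"
    using swappable_letter[of w "inv_letter c"] commutes_bar_letter[of "inv_letter c"] by auto
  then show ?case
    using swappable_iff_commutes_bar by fastforce
qed

end

section \<open>Presented groups\<close>

lemma equivclp_context:
  assumes ctx: "\<And>u v x y. r u v \<Longrightarrow> r (x @ u @ y) (x @ v @ y)" and "equivclp r u v"
  shows "equivclp r (x @ u @ y) (x @ v @ y)"
  using assms(2)
proof (induction rule: equivclp_induct)
  case (step v w)
  then have "r (x @ v @ y) (x @ w @ y) \<or> r (x @ w @ y) (x @ v @ y)"
    using ctx by blast
  with step.IH show ?case
    by (rule equivclp_into_equivclp)
qed simp

lemma equivclp_append: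
  assumes ctx: "\<And>u v x y. r u v \<Longrightarrow> r (x @ u @ y) (x @ v @ y)"
    and "equivclp r u u'" "equivclp r v v'"
  shows "equivclp r (u @ v) (u' @ v')"
proof -
  have "equivclp r (u @ v) (u' @ v)"
    using equivclp_context[of r u u' "[]" v] ctx assms(2) by simp
  moreover have "equivclp r (u' @ v) (u' @ v')"
    using equivclp_context[of r v v' u' "[]"] ctx assms(3) by simp
  ultimately show ?thesis
    by (rule equivclp_trans)
qed

lemma equivclp_class_eq_iff: "{z. equivclp r x z} = {z. equivclp r y z} \<longleftrightarrow> equivclp r x y"
  using equivclp_refl[of r y] by (auto dest: equivclp_sym equivclp_trans simp: set_eq_iff)

text \<open>Common to free groups and free products, whose products are defined as unions over all
  representatives: all members of the union coincide, and the index sets are nonempty.\<close>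

lemma equivclp_class_mult:
  assumes ctx: "\<And>u v x y. r u v \<Longrightarrow> r (x @ u @ y) (x @ v @ y)"
  shows "(\<Union>u\<in>{z. equivclp r x z}. \<Union>v\<in>{z. equivclp r y z}. {z. equivclp r (u @ v) z})
    = {z. equivclp r (x @ y) z}"
proof -
  have eq: "{z. equivclp r (u @ v) z} = {z. equivclp r (x @ y) z}"
    if "equivclp r x u" "equivclp r y v" for u v
    using equivclp_append[of r, OF ctx that] equivclp_class_eq_iff by metis
  have "(\<Union>u\<in>{z. equivclp r x z}. \<Union>v\<in>{z. equivclp r y z}. {z. equivclp r (u @ v) z})
      = (\<Union>u\<in>{z. equivclp r x z}. \<Union>v\<in>{z. equivclp r y z}. {z. equivclp r (x @ y) z})"
    by (intro SUP_cong refl eq) simp_all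
  also have "\<dots> = {z. equivclp r (x @ y) z}"
  proof -
    have "{z. equivclp r x z} \<noteq> {}" for x
      using equivclp_refl[of r x] by blast
    then show ?thesis
      by (simp only: UN_constant if_False)
  qed
  finally show ?thesis .
qed

text \<open>A function constant on the fibres of \<open>c\<close> descends to the image of
  \<open>c\<close>; this defines homomorphisms out of groups of classes.\<close>

lemma factor_through:
  assumes "\<And>x y. x \<in> A \<Longrightarrow> y \<in> A \<Longrightarrow> c x = c y \<Longrightarrow> f x = f y"
  shows "\<exists>h. \<forall>x\<in>A. h (c x) = f x"
proof (rule exI[of _ "\<lambda>y. f (inv_into A c y)"], rule ballI)
  show "f (inv_into A c (c x)) = f x" if "x \<in> A" for x
    using that assms[OF inv_into_into[of "c x" c A] that] by (simp add: f_inv_into_f)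
qed

section \<open>Quotients by normal closures\<close>

lemma (in group) normal_closure_normal:
  assumes "T \<subseteq> carrier G"
  shows "normal_closure G T \<lhd> G"
  unfolding normal_closure_def
proof (intro iffD2[OF normal_inv_iff] conjI subgroups_Inter ballI InterI)
  \<comment> \<open>The whole group belongs to the family, so the intersection is not over the empty
    family.\<close>
  show "{N. N \<lhd> G \<and> T \<subseteq> N} \<noteq> {}"
    using assms normal_self by blast
qed (auto simp: normal_imp_subgroup dest: normal.inv_op_closed2)

lemma normal_closure_superset: "T \<subseteq> normal_closure G T"
  by (auto simp: normal_closure_def)

lemma normal_closure_least: "N \<lhd> G \<Longrightarrow> T \<subseteq> N \<Longrightarrow> normal_closure G T \<subseteq> N"
  by (auto simp: normal_closure_def)

lemma (in group) normal_closure_lift: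
  assumes "group K" "h \<in> hom G K" "T \<subseteq> carrier G" "\<And>t. t \<in> T \<Longrightarrow> h t = \<one>\<^bsub>K\<^esub>"
  obtains k where "k \<in> hom (G Mod normal_closure G T) K"
    "\<And>g. g \<in> carrier G \<Longrightarrow> k (normal_closure G T #> g) = h g"
proof -
  interpret h: group_hom G K h
    using assms by (simp add: group_hom_def group_hom_axioms_def is_group)
  have "normal_closure G T \<subseteq> kernel G K h"
    using assms by (intro normal_closure_least h.normal_kernel) (auto simp: kernel_def)
  then show ?thesis
    using that h.FactGroup_universal_kernel normal_closure_normal[OF assms(3)] by blast
qed

lemma (in group) coset_eq_one_FactGroup:
  assumes "N \<lhd> G" "g \<in> N"
  shows "N #> g = \<one>\<^bsub>G Mod N\<^esub>"
  using coset_join2[OF subgroup.mem_carrier[OF normal_imp_subgroup[OF assms(1)] assms(2)]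
      normal_imp_subgroup[OF assms(1)] assms(2)]
  by simp

section \<open>Free groups\<close>

lemma free_step_context: "free_step X u v \<Longrightarrow> free_step X (x @ u @ y) (x @ v @ y)"
proof (induction rule: free_step.induct)
  case (1 l us vs)
  then show ?case
    using free_step.intros[of l X "x @ us" "vs @ y"] by simp
qed

lemma free_class_eq_iff: "free_class X v = free_class X w \<longleftrightarrow> equivclp (free_step X) v w"
  unfolding free_class_def by (rule equivclp_class_eq_iff)

lemma mult_free_group [simp]:
  "free_class X v \<otimes>\<^bsub>free_group X\<^esub> free_class X w = free_class X (v @ w)"
  unfolding free_group_def free_class_def by (simp add: equivclp_class_mult free_step_context)

lemma one_free_group: "\<one>\<^bsub>free_group X\<^esub> = free_class X []"
  by (simp add: free_group_def)

lemma carrier_free_group: "carrier (free_group X) = free_class X ` words X"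
  by (simp add: free_group_def)

lemma free_class_inv_word:
  assumes "w \<in> words X"
  shows "free_class X (inv_word w @ w) = free_class X []"
  using assms
proof (induction w)
  case (Cons l w)
  then have "free_step X (inv_word w @ [inv_letter l, inv_letter (inv_letter l)] @ w) (inv_word w @ w)"
    by (intro free_step.intros) simp
  then have "free_class X (inv_word (l # w) @ l # w) = free_class X (inv_word w @ w)"
    by (simp add: free_class_eq_iff r_into_equivclp)
  then show ?case
    using Cons by simp
qed simp

lemma group_free_group: "group (free_group X)"
proof (rule groupI)
  fix x assume "x \<in> carrier (free_group X)"
  then obtain w where w: "w \<in> words X" "x = free_class X w"
    by (auto simp: carrier_free_group)
  then show "\<exists>y\<in>carrier (free_group X). y \<otimes>\<^bsub>free_group X\<^esub> x = \<one>\<^bsub>free_group X\<^esub>"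
    by (intro bexI[of _ "free_class X (inv_word w)"])
      (auto simp: carrier_free_group one_free_group free_class_inv_word)
qed (auto simp: carrier_free_group one_free_group)

text \<open>The alphabet condition is shown to pass both ways, because a chain witnessing
  equivalence uses steps in both directions and values are controlled only for words over
  \<open>X\<close>.\<close>

lemma (in group) word_val_free_step:
  assumes "\<And>s. s \<in> X \<Longrightarrow> f s \<in> carrier G" "free_step X v w"
  shows "v \<in> words X \<longleftrightarrow> w \<in> words X" "w \<in> words X \<Longrightarrow> word_val G f v = word_val G f w"
  using assms(2)
proof (induction rule: free_step.induct)
  case (1 l us vs)
  {
    case 1
    show ?case
      using \<open>symb l \<in> X\<close> by simp
  next
    case 2
    then have "us \<in> words X" "vs \<in> words X" "[l, inv_letter l] @ vs \<in> words X"
      using \<open>symb l \<in> X\<close> by simp_all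
    moreover from this have "word_val G f ([l, inv_letter l] @ vs) = word_val G f vs"
      using \<open>symb l \<in> X\<close> letter_val_closed[of X f l] letter_val_inv_letter[of X f l]
        word_val_closed[of X f vs] assms(1) by simp
    ultimately show ?case
      by (simp only: word_val_append[of X f, OF assms(1)])
  }
qed

lemma (in group) word_val_free_class:
  assumes "\<And>s. s \<in> X \<Longrightarrow> f s \<in> carrier G" "v \<in> words X" "free_class X v = free_class X w"
  shows "word_val G f v = word_val G f w"
proof -
  have "equivclp (free_step X) v w"
    using assms(3) by (simp add: free_class_eq_iff)
  then have "w \<in> words X \<and> word_val G f v = word_val G f w"
  proof (induction rule: equivclp_induct)
    case (step w z)
    then show ?case
      using word_val_free_step[of X f, OF assms(1)] by metis
  qed (simp add: assms)
  then show ?thesis ..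
qed

lemma (in group) free_group_lift:
  assumes f: "\<And>s. s \<in> X \<Longrightarrow> f s \<in> carrier G"
  obtains h where "h \<in> hom (free_group X) G"
    "\<And>w. w \<in> words X \<Longrightarrow> h (free_class X w) = word_val G f w"
proof -
  obtain h where h: "\<And>w. w \<in> words X \<Longrightarrow> h (free_class X w) = word_val G f w"
    using factor_through[of "words X" "free_class X" "word_val G f"] word_val_free_class[of X f, OF f]
    by blast
  moreover have "h \<in> hom (free_group X) G"
    by (rule homI) (auto simp: carrier_free_group h word_val_closed[of X f, OF f] word_val_append[of X f, OF f])
  ultimately show ?thesis
    using that by blast
qed

section \<open>Groups given by generators and relators\<close>

definition presented_class :: "'x set \<Rightarrow> 'x word set \<Rightarrow> 'x word \<Rightarrow> 'x word set set" where
  "presented_class X R w = relator_closure X R #>\<^bsub>free_group X\<^esub> free_class X w"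

lemma presented_gen_eq: "presented_gen X R s = presented_class X R [Gen s]"
  by (simp add: presented_gen_def presented_class_def)

lemma normal_relator_closure:
  assumes "R \<subseteq> words X"
  shows "relator_closure X R \<lhd> free_group X"
  unfolding relator_closure_def using assms
  by (intro group.normal_closure_normal group_free_group) (auto simp: carrier_free_group)

lemma group_presented_group:
  assumes "R \<subseteq> words X"
  shows "group (presented_group X R)"
  unfolding presented_group_def
  by (rule normal.factorgroup_is_group[OF normal_relator_closure[OF assms]])

lemma carrier_presented_group: "carrier (presented_group X R) = presented_class X R ` words X"
  by (simp add: presented_group_def carrier_FactGroup carrier_free_group image_image presented_class_def)

lemma mult_presented_group:
  assumes "R \<subseteq> words X" "v \<in> words X" "w \<in> words X"
  shows "presented_class X R v \<otimes>\<^bsub>presented_group X R\<^esub> presented_class X R w = presented_class X R (v @ w)"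
  using normal.rcos_sum[OF normal_relator_closure[OF assms(1)]] assms
  by (simp add: presented_group_def presented_class_def carrier_free_group)

lemma presented_class_relator:
  assumes "R \<subseteq> words X" "r \<in> R"
  shows "presented_class X R r = \<one>\<^bsub>presented_group X R\<^esub>"
proof -
  have "free_class X r \<in> relator_closure X R"
    unfolding relator_closure_def
    using normal_closure_superset[of "free_class X ` R" "free_group X"] assms(2) by blast
  then show ?thesis
    unfolding presented_class_def presented_group_def
    using group.coset_eq_one_FactGroup[OF group_free_group normal_relator_closure[OF assms(1)]] by blast
qed

lemma presented_class_Nil:
  assumes "R \<subseteq> words X"
  shows "presented_class X R [] = \<one>\<^bsub>presented_group X R\<^esub>"
proof -
  have "\<one>\<^bsub>free_group X\<^esub> \<in> relator_closure X R"
    using normal_relator_closure[OF assms] normal_imp_subgroup subgroup.one_closed by blast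
  then show ?thesis
    unfolding presented_class_def presented_group_def one_free_group
    using group.coset_eq_one_FactGroup[OF group_free_group normal_relator_closure[OF assms]] by blast
qed

lemma presented_class_closed:
  "w \<in> words X \<Longrightarrow> presented_class X R w \<in> carrier (presented_group X R)"
  by (simp add: carrier_presented_group)

lemma word_val_presented_gen:
  assumes "R \<subseteq> words X" "w \<in> words X"
  shows "word_val (presented_group X R) (presented_gen X R) w = presented_class X R w"
  using assms(2)
proof (induction w)
  case Nil
  then show ?case
    by (simp add: presented_class_Nil assms)
next
  case (Cons l w)
  interpret P: group "presented_group X R"
    using assms(1) by (rule group_presented_group)
  have "letter_val (presented_group X R) (presented_gen X R) l = presented_class X R [l]"
  proof (cases l)
    case (GenInv s)
    have "free_class X ([GenInv s] @ [Gen s]) = free_class X []"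
      using free_class_inv_word[of "[Gen s]" X] GenInv Cons.prems by simp
    then have "presented_class X R ([GenInv s] @ [Gen s]) = \<one>\<^bsub>presented_group X R\<^esub>"
      using presented_class_Nil[OF assms(1)] by (simp add: presented_class_def)
    then have "presented_class X R [GenInv s] \<otimes>\<^bsub>presented_group X R\<^esub> presented_class X R [Gen s]
        = \<one>\<^bsub>presented_group X R\<^esub>"
      using mult_presented_group[OF assms(1), of "[GenInv s]" "[Gen s]"] GenInv Cons.prems by simp
    then have "inv\<^bsub>presented_group X R\<^esub> presented_class X R [Gen s] = presented_class X R [GenInv s]"
      using GenInv Cons.prems by (intro P.inv_equality presented_class_closed) simp_all
    then show ?thesis
      by (simp add: GenInv presented_gen_eq)
  qed (simp add: presented_gen_eq)
  then show ?case
    using Cons mult_presented_group[OF assms(1), of "[l]" w] by simp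
qed

lemma (in group) presented_group_lift:
  assumes f: "\<And>s. s \<in> X \<Longrightarrow> f s \<in> carrier G" and "R \<subseteq> words X"
    and "\<And>r. r \<in> R \<Longrightarrow> word_val G f r = \<one>"
  obtains h where "h \<in> hom (presented_group X R) G"
    "\<And>w. w \<in> words X \<Longrightarrow> h (presented_class X R w) = word_val G f w"
proof -
  obtain k where k: "k \<in> hom (free_group X) G"
    "\<And>w. w \<in> words X \<Longrightarrow> k (free_class X w) = word_val G f w"
    using free_group_lift[of X f] f by blast
  have R: "free_class X ` R \<subseteq> carrier (free_group X)"
    using assms(2) by (auto simp: carrier_free_group)
  have "k t = \<one>" if "t \<in> free_class X ` R" for t
    using that assms(2,3) k(2) by auto
  then obtain h where h: "h \<in> hom (free_group X Mod relator_closure X R) G"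
    "\<And>g. g \<in> carrier (free_group X) \<Longrightarrow> h (relator_closure X R #>\<^bsub>free_group X\<^esub> g) = k g"
    using group.normal_closure_lift[OF group_free_group is_group k(1) R]
    unfolding relator_closure_def by blast
  show ?thesis
  proof
    show "h \<in> hom (presented_group X R) G"
      using h(1) by (simp add: presented_group_def)
    show "h (presented_class X R w) = word_val G f w" if "w \<in> words X" for w
      using that h(2) k(2) by (simp add: presented_class_def carrier_free_group)
  qed
qed

lemma hom_word_val:
  assumes "group K" "group L" "h \<in> hom K L" "\<And>s. s \<in> X \<Longrightarrow> f s \<in> carrier K" "w \<in> words X"
  shows "h (word_val K f w) = word_val L (h \<circ> f) w"
proof -
  interpret h: group_hom K L h
    using assms by (simp add: group_hom_def group_hom_axioms_def)
  have "h (letter_val K f l) = letter_val L (h \<circ> f) l" if "symb l \<in> X" for l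
    using that assms(4) by (cases l) auto
  with assms(5) show ?thesis
    by (induction w)
      (auto simp: h.G.letter_val_closed[of X f] h.G.word_val_closed[of X f] assms(4))
qed

lemma word_val_cong:
  assumes "\<And>s. s \<in> X \<Longrightarrow> f s = g s" "w \<in> words X"
  shows "word_val K f w = word_val K g w"
proof -
  have "letter_val K f l = letter_val K g l" if "symb l \<in> X" for l
    using that assms(1) by (cases l) auto
  with assms(2) show ?thesis
    by (induction w) auto
qed

lemma word_val_map_letter: "word_val K f (map (map_letter h) w) = word_val K (f \<circ> h) w"
proof -
  have "letter_val K f (map_letter h l) = letter_val K (f \<circ> h) l" for l
    by (cases l) auto
  then show ?thesis
    by (induction w) auto
qed

lemma (in group) word_val_commutator_word:
  assumes f: "\<And>s. s \<in> X \<Longrightarrow> f s \<in> carrier G" and "v \<in> words X" "w \<in> words X"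
  shows "word_val G f (commutator_word v w) = commutator G (word_val G f v) (word_val G f w)"
  using assms(2,3)
  by (simp add: commutator_word_def commutator_def word_val_append[of X f, OF f]
      word_val_inv_word[of X f, OF f] word_val_closed[of X f, OF f] m_assoc)

lemma (in group_hom) hom_commutator:
  assumes "x \<in> carrier G" "y \<in> carrier G"
  shows "h (commutator G x y) = commutator H (h x) (h y)"
  using assms by (simp add: commutator_def)

text \<open>Extends the isomorphism from generators to values of arbitrary words, so that later
  arguments need not refer to cosets.\<close>

lemma has_presentationE:
  assumes "has_presentation G X a R"
  obtains \<psi> where "group G" "R \<subseteq> words X" "\<psi> \<in> iso (presented_group X R) G"
    "\<And>s. s \<in> X \<Longrightarrow> a s \<in> carrier G"
    "\<And>w. w \<in> words X \<Longrightarrow> \<psi> (presented_class X R w) = word_val G a w"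
proof -
  obtain \<psi> where \<psi>: "group G" "R \<subseteq> words X" "\<psi> \<in> iso (presented_group X R) G"
    "\<And>s. s \<in> X \<Longrightarrow> \<psi> (presented_gen X R s) = a s"
    using assms by (auto simp: has_presentation_def)
  have \<psi>_hom: "\<psi> \<in> hom (presented_group X R) G"
    using \<psi>(3) by (simp add: iso_def)
  have gen: "presented_gen X R s \<in> carrier (presented_group X R)" if "s \<in> X" for s
    using that by (simp add: presented_gen_eq presented_class_closed)
  show ?thesis
  proof
    show "a s \<in> carrier G" if "s \<in> X" for s
      using hom_in_carrier[OF \<psi>_hom gen] \<psi>(4) that by metis
    show "\<psi> (presented_class X R w) = word_val G a w" if "w \<in> words X" for w
    proof -
      have "\<psi> (presented_class X R w) = word_val G (\<psi> \<circ> presented_gen X R) w"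
        using hom_word_val[OF group_presented_group[OF \<psi>(2)] \<psi>(1) \<psi>_hom, of X "presented_gen X R" w]
          gen that \<psi>(2) by (simp add: word_val_presented_gen)
      also have "\<dots> = word_val G a w"
        using that \<psi>(4) by (intro word_val_cong[of X]) simp_all
      finally show ?thesis .
    qed
  qed (fact \<psi>)+
qed

lemma has_presentation_word:
  assumes "has_presentation G X a R" "g \<in> carrier G"
  obtains w where "w \<in> words X" "g = word_val G a w"
proof (rule has_presentationE[OF assms(1)])
  fix \<psi>
  assume "\<psi> \<in> iso (presented_group X R) G"
    and val: "\<And>w. w \<in> words X \<Longrightarrow> \<psi> (presented_class X R w) = word_val G a w"
  then have "g \<in> \<psi> ` presented_class X R ` words X"
    using assms(2) by (simp add: iso_def bij_betw_def carrier_presented_group)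
  then show ?thesis
    using that val by auto
qed

lemma has_presentation_relator:
  assumes "has_presentation G X a R" "r \<in> R"
  shows "word_val G a r = \<one>\<^bsub>G\<^esub>"
proof (rule has_presentationE[OF assms(1)])
  fix \<psi>
  assume *: "group G" "R \<subseteq> words X" "\<psi> \<in> iso (presented_group X R) G"
    and val: "\<And>w. w \<in> words X \<Longrightarrow> \<psi> (presented_class X R w) = word_val G a w"
  then have "\<psi> \<one>\<^bsub>presented_group X R\<^esub> = \<one>\<^bsub>G\<^esub>"
    using hom_one[of \<psi> "presented_group X R" G] group_presented_group by (auto simp: iso_def)
  then show ?thesis
    using val[of r] * assms(2) presented_class_relator[of R X r] by auto
qed

text \<open>Von Dyck's theorem, transported along the isomorphism with the presented group.\<close>

lemma has_presentation_lift:
  assumes "has_presentation G X a R" "group K" "\<And>s. s \<in> X \<Longrightarrow> f s \<in> carrier K"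
    and "\<And>r. r \<in> R \<Longrightarrow> word_val K f r = \<one>\<^bsub>K\<^esub>"
  obtains h where "h \<in> hom G K" "\<And>w. w \<in> words X \<Longrightarrow> h (word_val G a w) = word_val K f w"
proof (rule has_presentationE[OF assms(1)])
  fix \<psi>
  assume *: "group G" "R \<subseteq> words X" "\<psi> \<in> iso (presented_group X R) G"
    and val: "\<And>w. w \<in> words X \<Longrightarrow> \<psi> (presented_class X R w) = word_val G a w"
  interpret P: group "presented_group X R"
    using *(2) by (rule group_presented_group)
  let ?\<xi> = "inv_into (carrier (presented_group X R)) \<psi>"
  have \<xi>: "?\<xi> \<in> hom G (presented_group X R)"
    using P.iso_set_sym[OF *(3)] by (simp add: iso_def)
  obtain k where k: "k \<in> hom (presented_group X R) K"
    "\<And>w. w \<in> words X \<Longrightarrow> k (presented_class X R w) = word_val K f w"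
    using group.presented_group_lift[OF assms(2), of X f R] assms(3,4) *(2) by blast
  show ?thesis
  proof
    show "k \<circ> ?\<xi> \<in> hom G K"
      using \<xi> k(1) by (rule hom_compose)
    show "(k \<circ> ?\<xi>) (word_val G a w) = word_val K f w" if "w \<in> words X" for w
    proof -
      have "?\<xi> (\<psi> (presented_class X R w)) = presented_class X R w"
        using *(3) that by (intro inv_into_f_f) (auto simp: iso_def bij_betw_def presented_class_closed)
      then show ?thesis
        using that val k(2) by simp
    qed
  qed
qed

text \<open>The relators give the canonical map from the presented group to \<open>K\<close>. A
  homomorphism \<open>h\<close> back that fixes the generators is a left inverse of it, hence
  injectivity; surjectivity is the assumption that words exhaust \<open>K\<close>.\<close>

lemma has_presentationI:
  assumes "group K" "R \<subseteq> words X" "\<And>s. s \<in> X \<Longrightarrow> a s \<in> carrier K"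
    and "\<And>r. r \<in> R \<Longrightarrow> word_val K a r = \<one>\<^bsub>K\<^esub>"
    and "h \<in> hom K (presented_group X R)" "\<And>s. s \<in> X \<Longrightarrow> h (a s) = presented_gen X R s"
    and surj: "\<And>g. g \<in> carrier K \<Longrightarrow> \<exists>w\<in>words X. g = word_val K a w"
  shows "has_presentation K X a R"
proof -
  obtain \<psi> where \<psi>: "\<psi> \<in> hom (presented_group X R) K"
    "\<And>w. w \<in> words X \<Longrightarrow> \<psi> (presented_class X R w) = word_val K a w"
    using group.presented_group_lift[OF assms(1), of X a R] assms(2-4) by blast
  have gen: "\<psi> (presented_gen X R s) = a s" if "s \<in> X" for s
    using that \<psi>(2)[of "[Gen s]"] assms(1,3) by (simp add: presented_gen_eq group.is_monoid)
  have inverse: "h (\<psi> (presented_class X R w)) = presented_class X R w" if "w \<in> words X" for w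
  proof -
    have "h (\<psi> (presented_class X R w)) = word_val (presented_group X R) (h \<circ> a) w"
      using that \<psi>(2) hom_word_val[OF assms(1) group_presented_group[OF assms(2)] assms(5), of X a w]
        assms(3) by simp
    also have "\<dots> = word_val (presented_group X R) (presented_gen X R) w"
      using that assms(6) by (intro word_val_cong[of X]) simp_all
    finally show ?thesis
      using that assms(2) by (simp add: word_val_presented_gen)
  qed
  have "inj_on \<psi> (carrier (presented_group X R))"
    by (rule inj_on_inverseI[of _ h]) (auto simp: carrier_presented_group inverse)
  moreover have "\<psi> ` carrier (presented_group X R) = carrier K"
  proof
    show "carrier K \<subseteq> \<psi> ` carrier (presented_group X R)"
      using surj \<psi>(2) presented_class_closed by (metis image_eqI subsetI)
  qed (use hom_carrier[OF \<psi>(1)] in blast)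
  ultimately have "\<psi> \<in> iso (presented_group X R) K"
    using \<psi>(1) by (simp add: iso_def bij_betw_def)
  then show ?thesis
    using assms(1,2) gen by (auto simp: has_presentation_def)
qed

section \<open>Words of a free product and their values\<close>

fun fprod_val ::
    "('k, 'b) monoid_scheme \<Rightarrow> ('g \<Rightarrow> 'k) \<Rightarrow> ('h \<Rightarrow> 'k) \<Rightarrow> ('g + 'h) list \<Rightarrow> 'k" where
  "fprod_val K f g [] = \<one>\<^bsub>K\<^esub>"
| "fprod_val K f g (z # w) = case_sum f g z \<otimes>\<^bsub>K\<^esub> fprod_val K f g w"

lemma fprod_step_context: "fprod_step G H u v \<Longrightarrow> fprod_step G H (x @ u @ y) (x @ v @ y)"
proof (induction rule: fprod_step.induct)
  case (1 s t us vs)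
  then show ?case
    using fprod_step.intros(1)[of s G t H "x @ us" "vs @ y"] by simp
next
  case (2 us vs)
  then show ?case
    using fprod_step.intros(2)[of G H "x @ us" "vs @ y"] by simp
next
  case (3 s t us vs)
  then show ?case
    using fprod_step.intros(3)[of s H t G "x @ us" "vs @ y"] by simp
next
  case (4 us vs)
  then show ?case
    using fprod_step.intros(4)[of G H "x @ us" "vs @ y"] by simp
qed

lemma fprod_class_eq_iff: "fprod_class G H v = fprod_class G H w \<longleftrightarrow> equivclp (fprod_step G H) v w"
  unfolding fprod_class_def by (rule equivclp_class_eq_iff)

lemma mult_free_product [simp]:
  "fprod_class G H v \<otimes>\<^bsub>free_product G H\<^esub> fprod_class G H w = fprod_class G H (v @ w)"
  unfolding free_product_def fprod_class_def by (simp add: equivclp_class_mult fprod_step_context)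

lemma one_free_product: "\<one>\<^bsub>free_product G H\<^esub> = fprod_class G H []"
  by (simp add: free_product_def)

lemma carrier_free_product:
  "carrier (free_product G H) = fprod_class G H ` lists (carrier G <+> carrier H)"
  by (simp add: free_product_def)

section \<open>Free products and weak commutativity\<close>

locale group_pair = G: group G + H: group H
  for G :: "('g, 'p) monoid_scheme" (structure) and H :: "('h, 'q) monoid_scheme" (structure)
begin

abbreviation F :: "('g + 'h) list set monoid" where "F \<equiv> free_product G H"
abbreviation letters :: "('g + 'h) set" where "letters \<equiv> carrier G <+> carrier H"

text \<open>Cancellation takes two steps: the letter and its inverse merge into an identity letter,
  which is then deleted.\<close>

lemma fprod_class_cancel:
  assumes "z \<in> letters"
  obtains z' where "z' \<in> letters" "\<And>v w. fprod_class G H (v @ [z', z] @ w) = fprod_class G H (v @ w)"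
proof (cases z)
  case (Inl g)
  then have "fprod_class G H (v @ [Inl (inv\<^bsub>G\<^esub> g), z] @ w) = fprod_class G H (v @ [Inl \<one>\<^bsub>G\<^esub>] @ w)" for v w
    using assms fprod_step.intros(1)[of "inv\<^bsub>G\<^esub> g" G g H v w]
    by (auto simp: fprod_class_eq_iff intro: r_into_equivclp)
  moreover have "fprod_class G H (v @ [Inl \<one>\<^bsub>G\<^esub>] @ w) = fprod_class G H (v @ w)" for v w
    using fprod_step.intros(2)[of G H v w] by (auto simp: fprod_class_eq_iff intro: r_into_equivclp)
  ultimately show ?thesis
    using that[of "Inl (inv\<^bsub>G\<^esub> g)"] assms Inl by auto
next
  case (Inr g)
  then have "fprod_class G H (v @ [Inr (inv\<^bsub>H\<^esub> g), z] @ w) = fprod_class G H (v @ [Inr \<one>\<^bsub>H\<^esub>] @ w)" for v w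
    using assms fprod_step.intros(3)[of "inv\<^bsub>H\<^esub> g" H g G v w]
    by (auto simp: fprod_class_eq_iff intro: r_into_equivclp)
  moreover have "fprod_class G H (v @ [Inr \<one>\<^bsub>H\<^esub>] @ w) = fprod_class G H (v @ w)" for v w
    using fprod_step.intros(4)[of G H v w] by (auto simp: fprod_class_eq_iff intro: r_into_equivclp)
  ultimately show ?thesis
    using that[of "Inr (inv\<^bsub>H\<^esub> g)"] assms Inr by auto
qed

lemma fprod_class_left_inverse:
  assumes "w \<in> lists letters"
  shows "\<exists>v\<in>lists letters. fprod_class G H (v @ w) = fprod_class G H []"
  using assms
proof (induction w)
  case Nil
  then show ?case
    by (intro bexI[of _ "[]"]) auto
next
  case (Cons z w)
  then obtain v where v: "v \<in> lists letters" "fprod_class G H (v @ w) = fprod_class G H []"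
    by blast
  obtain z' where "z' \<in> letters" "\<And>v w. fprod_class G H (v @ [z', z] @ w) = fprod_class G H (v @ w)"
    using fprod_class_cancel Cons(1) by blast
  with v show ?case
    by (intro bexI[of _ "v @ [z']"]) simp_all
qed

lemma group_free_product: "group F"
proof (rule groupI)
  fix x assume "x \<in> carrier F"
  then obtain w where w: "w \<in> lists letters" "x = fprod_class G H w"
    by (auto simp: carrier_free_product)
  then obtain v where "v \<in> lists letters" "fprod_class G H (v @ w) = fprod_class G H []"
    using fprod_class_left_inverse by blast
  then show "\<exists>y\<in>carrier F. y \<otimes>\<^bsub>F\<^esub> x = \<one>\<^bsub>F\<^esub>"
    using w by (intro bexI[of _ "fprod_class G H v"]) (simp_all add: carrier_free_product one_free_product)
qed (auto simp: carrier_free_product one_free_product intro!: imageI)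

context
  fixes K :: "('k, 'c) monoid_scheme" and f g
  assumes K: "group K" and f: "f \<in> hom G K" and g: "g \<in> hom H K"
begin

interpretation K: group K by (rule K)
interpretation f: group_hom G K f
  using f by (simp add: group_hom_def group_hom_axioms_def G.is_group K)
interpretation g: group_hom H K g
  using g by (simp add: group_hom_def group_hom_axioms_def H.is_group K)

lemma fprod_val_closed: "w \<in> lists letters \<Longrightarrow> fprod_val K f g w \<in> carrier K"
  by (induction w) auto

lemma fprod_val_append:
  "v \<in> lists letters \<Longrightarrow> w \<in> lists letters \<Longrightarrow>
    fprod_val K f g (v @ w) = fprod_val K f g v \<otimes>\<^bsub>K\<^esub> fprod_val K f g w"
proof (induction v)
  case (Cons z v)
  then show ?case
    using fprod_val_closed[of v] fprod_val_closed[of w] by (auto simp: K.m_assoc)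
qed (simp add: fprod_val_closed)

lemma fprod_val_step:
  assumes "fprod_step G H v w"
  shows "v \<in> lists letters \<longleftrightarrow> w \<in> lists letters"
    "w \<in> lists letters \<Longrightarrow> fprod_val K f g v = fprod_val K f g w"
proof -
  have *: "(us @ vs @ ws \<in> lists letters \<longleftrightarrow> us @ vs' @ ws \<in> lists letters) \<and>
      (us @ vs' @ ws \<in> lists letters \<longrightarrow> fprod_val K f g (us @ vs @ ws) = fprod_val K f g (us @ vs' @ ws))"
    if "vs \<in> lists letters" "vs' \<in> lists letters" "fprod_val K f g vs = fprod_val K f g vs'"
    for us vs vs' ws
    using that by (simp add: fprod_val_append)
  from assms have "(v \<in> lists letters \<longleftrightarrow> w \<in> lists letters) \<and>
      (w \<in> lists letters \<longrightarrow> fprod_val K f g v = fprod_val K f g w)"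
  proof cases
    case (1 s t us ws)
    then show ?thesis
      using *[of "[Inl s, Inl t]" "[Inl (s \<otimes>\<^bsub>G\<^esub> t)]" us ws] by (simp add: K.m_assoc InlI InrI)
  next
    case (2 us ws)
    then show ?thesis
      using *[of "[Inl \<one>\<^bsub>G\<^esub>]" "[]" us ws] by (simp add: InlI InrI)
  next
    case (3 s t us ws)
    then show ?thesis
      using *[of "[Inr s, Inr t]" "[Inr (s \<otimes>\<^bsub>H\<^esub> t)]" us ws] by (simp add: K.m_assoc InlI InrI)
  next
    case (4 us ws)
    then show ?thesis
      using *[of "[Inr \<one>\<^bsub>H\<^esub>]" "[]" us ws] by (simp add: InlI InrI)
  qed
  then show "v \<in> lists letters \<longleftrightarrow> w \<in> lists letters"
    "w \<in> lists letters \<Longrightarrow> fprod_val K f g v = fprod_val K f g w"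
    by blast+
qed

text \<open>The universal property of the free product; evaluation of words in \<open>K\<close> is
  invariant under steps and hence defined on classes.\<close>

lemma free_product_lift:
  obtains h where "h \<in> hom F K" "\<And>x. x \<in> carrier G \<Longrightarrow> h (fprod_class G H [Inl x]) = f x"
    "\<And>y. y \<in> carrier H \<Longrightarrow> h (fprod_class G H [Inr y]) = g y"
proof -
  have eq: "fprod_val K f g v = fprod_val K f g w"
    if "v \<in> lists letters" "w \<in> lists letters" "fprod_class G H v = fprod_class G H w" for v w
  proof -
    have "equivclp (fprod_step G H) v w"
      using that(3) by (simp add: fprod_class_eq_iff)
    then have "w \<in> lists letters \<and> fprod_val K f g v = fprod_val K f g w"
    proof (induction rule: equivclp_induct)
      case (step w z)
      then show ?case
        using fprod_val_step[of w z] fprod_val_step[of z w] by presburger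
    qed (use that(1) in blast)
    then show ?thesis ..
  qed
  obtain h where h: "\<And>w. w \<in> lists letters \<Longrightarrow> h (fprod_class G H w) = fprod_val K f g w"
    using factor_through[of "lists letters" "fprod_class G H" "fprod_val K f g", OF eq] by blast
  show ?thesis
  proof
    show "h \<in> hom F K"
    proof (rule homI)
      fix v w assume "v \<in> carrier F" "w \<in> carrier F"
      then obtain v' w' where v: "v' \<in> lists letters" "v = fprod_class G H v'"
        and w: "w' \<in> lists letters" "w = fprod_class G H w'"
        by (auto simp: carrier_free_product)
      have "v' @ w' \<in> lists letters"
        using v(1) w(1) by simp
      with v w show "h (v \<otimes>\<^bsub>F\<^esub> w) = h v \<otimes>\<^bsub>K\<^esub> h w"
        by (simp only: mult_free_product h fprod_val_append)
    next
      fix v assume "v \<in> carrier F"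
      then obtain v' where "v' \<in> lists letters" "v = fprod_class G H v'"
        unfolding carrier_free_product by blast
      then show "h v \<in> carrier K"
        by (simp only: h fprod_val_closed)
    qed
    show "h (fprod_class G H [Inl x]) = f x" if "x \<in> carrier G" for x
      using that h[of "[Inl x]"] by (simp add: InlI)
    show "h (fprod_class G H [Inr y]) = g y" if "y \<in> carrier H" for y
      using that h[of "[Inr y]"] by (simp add: InrI)
  qed
qed

end

end


section \<open>The weak commutativity group and its universal property\<close>

locale weak_comm = group_pair G H
  for G :: "('g, 'p) monoid_scheme" (structure) and H :: "('h, 'q) monoid_scheme" (structure) +
  fixes \<phi> :: "'g \<Rightarrow> 'h"
  assumes \<phi>: "\<phi> \<in> iso G H"
begin

abbreviation N where "N \<equiv> weak_comm_kernel G H \<phi>"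
abbreviation V where "V \<equiv> weak_comm_group G H \<phi>"
abbreviation elem where "elem \<equiv> weak_comm_elem G H \<phi>"

definition relators :: "('g + 'h) list set set" where
  "relators = {commutator F (fprod_class G H [Inl g]) (fprod_class G H [Inr (\<phi> g)]) | g. g \<in> carrier G}"

lemma \<phi>_hom: "\<phi> \<in> hom G H" and \<phi>_bij: "bij_betw \<phi> (carrier G) (carrier H)"
  using \<phi> by (auto simp: iso_def)

lemma \<phi>_closed: "g \<in> carrier G \<Longrightarrow> \<phi> g \<in> carrier H"
  using \<phi>_hom by (rule hom_in_carrier)

lemma fprod_letter_closed:
  "x \<in> carrier G \<Longrightarrow> fprod_class G H [Inl x] \<in> carrier F"
  "y \<in> carrier H \<Longrightarrow> fprod_class G H [Inr y] \<in> carrier F"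
  by (auto simp: carrier_free_product intro!: imageI)

lemma relators_closed: "relators \<subseteq> carrier F"
  unfolding relators_def
  using group.commutator_closed[OF group_free_product] fprod_letter_closed \<phi>_closed by blast

lemma N_eq: "N = normal_closure F relators"
  by (simp add: weak_comm_kernel_def relators_def)

lemma normal_N: "N \<lhd> F"
  unfolding N_eq by (rule group.normal_closure_normal[OF group_free_product relators_closed])

lemma group_V: "group V"
  unfolding weak_comm_group_def by (rule normal.factorgroup_is_group[OF normal_N])

lemma coset_hom: "(\<lambda>x. N #>\<^bsub>F\<^esub> x) \<in> hom F V"
  unfolding weak_comm_group_def by (rule normal.r_coset_hom_Mod[OF normal_N])

lemma elem_Inl_hom: "(\<lambda>x. elem (Inl x)) \<in> hom G V"
proof (rule homI)
  show "elem (Inl x) \<in> carrier V" if "x \<in> carrier G" for x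
    unfolding weak_comm_elem_def using hom_in_carrier[OF coset_hom] fprod_letter_closed(1) that .
  show "elem (Inl (x \<otimes>\<^bsub>G\<^esub> y)) = elem (Inl x) \<otimes>\<^bsub>V\<^esub> elem (Inl y)"
    if "x \<in> carrier G" "y \<in> carrier G" for x y
  proof -
    have "fprod_class G H [Inl x, Inl y] = fprod_class G H [Inl (x \<otimes>\<^bsub>G\<^esub> y)]"
      using fprod_step.intros(1)[OF that, of H "[]" "[]"]
      by (simp add: fprod_class_eq_iff r_into_equivclp)
    then show ?thesis
      using hom_mult[OF coset_hom fprod_letter_closed(1)[OF that(1)] fprod_letter_closed(1)[OF that(2)]]
      by (simp add: weak_comm_elem_def)
  qed
qed

lemma elem_Inr_hom: "(\<lambda>y. elem (Inr y)) \<in> hom H V"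
proof (rule homI)
  show "elem (Inr x) \<in> carrier V" if "x \<in> carrier H" for x
    unfolding weak_comm_elem_def using hom_in_carrier[OF coset_hom] fprod_letter_closed(2) that .
  show "elem (Inr (x \<otimes>\<^bsub>H\<^esub> y)) = elem (Inr x) \<otimes>\<^bsub>V\<^esub> elem (Inr y)"
    if "x \<in> carrier H" "y \<in> carrier H" for x y
  proof -
    have "fprod_class G H [Inr x, Inr y] = fprod_class G H [Inr (x \<otimes>\<^bsub>H\<^esub> y)]"
      using fprod_step.intros(3)[OF that, of G "[]" "[]"]
      by (simp add: fprod_class_eq_iff r_into_equivclp)
    then show ?thesis
      using hom_mult[OF coset_hom fprod_letter_closed(2)[OF that(1)] fprod_letter_closed(2)[OF that(2)]]
      by (simp add: weak_comm_elem_def)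
  qed
qed

lemma elem_commute:
  assumes "g \<in> carrier G"
  shows "elem (Inl g) \<otimes>\<^bsub>V\<^esub> elem (Inr (\<phi> g)) = elem (Inr (\<phi> g)) \<otimes>\<^bsub>V\<^esub> elem (Inl g)"
proof -
  interpret c: group_hom F V "\<lambda>x. N #>\<^bsub>F\<^esub> x"
    using coset_hom by (simp add: group_hom_def group_hom_axioms_def group_free_product group_V)
  let ?r = "commutator F (fprod_class G H [Inl g]) (fprod_class G H [Inr (\<phi> g)])"
  have cl: "fprod_class G H [Inl g] \<in> carrier F" "fprod_class G H [Inr (\<phi> g)] \<in> carrier F"
    using assms fprod_letter_closed \<phi>_closed by blast+
  have "?r \<in> N"
    unfolding N_eq using normal_closure_superset[of relators F] assms by (auto simp: relators_def)
  then have "N #>\<^bsub>F\<^esub> ?r = \<one>\<^bsub>V\<^esub>"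
    unfolding weak_comm_group_def
    by (rule group.coset_eq_one_FactGroup[OF group_free_product normal_N])
  then have "commutator V (elem (Inl g)) (elem (Inr (\<phi> g))) = \<one>\<^bsub>V\<^esub>"
    using c.hom_commutator[OF cl] by (simp add: weak_comm_elem_def)
  then show ?thesis
    using group.commutator_eq_one_iff[OF group_V] hom_in_carrier[OF elem_Inl_hom]
      hom_in_carrier[OF elem_Inr_hom] assms \<phi>_closed by blast
qed

text \<open>The pair of maps extends to the free product, and the commutation assumption says
  precisely that this extension kills the defining commutators.\<close>

lemma weak_comm_lift:
  assumes "group K" "f \<in> hom G K" "g \<in> hom H K"
    and "\<And>x. x \<in> carrier G \<Longrightarrow> f x \<otimes>\<^bsub>K\<^esub> g (\<phi> x) = g (\<phi> x) \<otimes>\<^bsub>K\<^esub> f x"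
  obtains h where "h \<in> hom V K" "\<And>x. x \<in> carrier G \<Longrightarrow> h (elem (Inl x)) = f x"
    "\<And>y. y \<in> carrier H \<Longrightarrow> h (elem (Inr y)) = g y"
proof -
  obtain k where k: "k \<in> hom F K" "\<And>x. x \<in> carrier G \<Longrightarrow> k (fprod_class G H [Inl x]) = f x"
    "\<And>y. y \<in> carrier H \<Longrightarrow> k (fprod_class G H [Inr y]) = g y"
    using free_product_lift[OF assms(1-3)] by blast
  interpret k: group_hom F K k
    using k(1) assms(1) by (simp add: group_hom_def group_hom_axioms_def group_free_product)
  have "k t = \<one>\<^bsub>K\<^esub>" if t: "t \<in> relators" for t
  proof -
    obtain x where x: "x \<in> carrier G"
      "t = commutator F (fprod_class G H [Inl x]) (fprod_class G H [Inr (\<phi> x)])"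
      using t by (auto simp: relators_def)
    note \<phi>x = \<phi>_closed[OF x(1)]
    have "k t = commutator K (f x) (g (\<phi> x))"
      unfolding x(2) k.hom_commutator[OF fprod_letter_closed(1)[OF x(1)] fprod_letter_closed(2)[OF \<phi>x]]
      by (simp only: k(2)[OF x(1)] k(3)[OF \<phi>x])
    also have "\<dots> = \<one>\<^bsub>K\<^esub>"
      using group.commutator_eq_one_iff[OF assms(1) hom_in_carrier[OF assms(2) x(1)]
          hom_in_carrier[OF assms(3) \<phi>x]] assms(4)[OF x(1)] by blast
    finally show ?thesis .
  qed
  then obtain h where "h \<in> hom (F Mod N) K" "\<And>x. x \<in> carrier F \<Longrightarrow> h (N #>\<^bsub>F\<^esub> x) = k x"
    unfolding N_eq using group.normal_closure_lift[OF group_free_product assms(1) k(1) relators_closed]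
    by blast
  then show ?thesis
    using that k(2,3) fprod_letter_closed by (simp add: weak_comm_elem_def weak_comm_group_def)
qed

text \<open>Expresses that the two copies generate the quotient; inverses need no case because each
  copy is a whole group.\<close>

lemma V_induct [consumes 1, case_names one Inl Inr]:
  assumes "v \<in> carrier V" "Q \<one>\<^bsub>V\<^esub>"
    and "\<And>x v. x \<in> carrier G \<Longrightarrow> v \<in> carrier V \<Longrightarrow> Q v \<Longrightarrow> Q (elem (Inl x) \<otimes>\<^bsub>V\<^esub> v)"
    and "\<And>y v. y \<in> carrier H \<Longrightarrow> v \<in> carrier V \<Longrightarrow> Q v \<Longrightarrow> Q (elem (Inr y) \<otimes>\<^bsub>V\<^esub> v)"
  shows "Q v"
proof -
  have closed: "fprod_class G H w \<in> carrier F" if "w \<in> lists letters" for w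
    using that unfolding carrier_free_product by (rule imageI)
  have "Q (N #>\<^bsub>F\<^esub> fprod_class G H w)" if "w \<in> lists letters" for w
    using that
  proof (induction w)
    case Nil
    have "N #>\<^bsub>F\<^esub> \<one>\<^bsub>F\<^esub> = \<one>\<^bsub>V\<^esub>"
      using hom_one[OF coset_hom group_free_product group_V] .
    then show ?case
      using assms(2) by (simp add: one_free_product)
  next
    case (Cons z w)
    have z: "[z] \<in> lists letters"
      using Cons(1) by simp
    have "N #>\<^bsub>F\<^esub> fprod_class G H (z # w) = elem z \<otimes>\<^bsub>V\<^esub> (N #>\<^bsub>F\<^esub> fprod_class G H w)"
      using hom_mult[OF coset_hom closed[OF z] closed[OF Cons(2)]] by (simp add: weak_comm_elem_def)
    then show ?case
      using Cons assms(3,4) hom_in_carrier[OF coset_hom closed[OF Cons(2)]] by auto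
  qed
  moreover obtain w where "w \<in> lists letters" "v = N #>\<^bsub>F\<^esub> fprod_class G H w"
    using assms(1) by (auto simp: weak_comm_group_def carrier_FactGroup carrier_free_product)
  ultimately show ?thesis
    by simp
qed

end

section \<open>The presentation\<close>

lemma unbar_word_words [simp]: "unbar_word w \<in> words (X <+> Y) \<longleftrightarrow> w \<in> words X"
proof -
  have "symb (map_letter Inl l) \<in> X <+> Y \<longleftrightarrow> symb l \<in> X" for l :: "'a letter"
    by (cases l) auto
  then show ?thesis
    by (induction w) (auto simp: unbar_word_def)
qed

lemma bar_word_words [simp]: "bar_word w \<in> words (X <+> Y) \<longleftrightarrow> w \<in> words Y"
proof -
  have "symb (map_letter Inr l) \<in> X <+> Y \<longleftrightarrow> symb l \<in> Y" for l :: "'a letter"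
    by (cases l) auto
  then show ?thesis
    by (induction w) (auto simp: bar_word_def)
qed

lemma word_val_unbar_word: "word_val K f (unbar_word w) = word_val K (\<lambda>s. f (Inl s)) w"
  by (simp add: unbar_word_def word_val_map_letter comp_def)

lemma word_val_bar_word: "word_val K f (bar_word w) = word_val K (\<lambda>s. f (Inr s)) w"
  by (simp add: bar_word_def word_val_map_letter comp_def)

lemma Upsilon_words: "Upsilon m \<subseteq> words {1..m}"
proof
  fix w assume "w \<in> Upsilon m"
  then show "w \<in> words {1..m}"
    unfolding Upsilon_def by (auto simp: words_map_Gen)
qed


theorem theorem1p5:
  fixes G :: "('g, 'p) monoid_scheme" and H :: "('h, 'q) monoid_scheme"
    and \<phi> :: "'g \<Rightarrow> 'h" and a :: "nat \<Rightarrow> 'g" and r :: "nat \<Rightarrow> nat word"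
    and m n :: nat
  assumes "has_presentation G {1..m} a (r ` {1..n})"
    and "group H" and "\<phi> \<in> iso G H"
  shows "has_presentation (weak_comm_group G H \<phi>)
           ({1..m} <+> {1..m})
           (case_sum (\<lambda>i. weak_comm_elem G H \<phi> (Inl (a i)))
                     (\<lambda>i. weak_comm_elem G H \<phi> (Inr (\<phi> (a i)))))
           ((\<lambda>k. unbar_word (r k)) ` {1..n} \<union> (\<lambda>k. bar_word (r k)) ` {1..n} \<union>
            {commutator_word (unbar_word w) (bar_word w) | w. w \<in> Upsilon m})"
    (is "has_presentation ?V (?X <+> ?X) ?c (?R1 \<union> ?R2 \<union> ?R3)")
proof -
  define R where "R = ?R1 \<union> ?R2 \<union> ?R3"
  define c where "c = ?c"
  have G: "group G" and r: "r ` {1..n} \<subseteq> words ?X" and a: "\<And>i. i \<in> ?X \<Longrightarrow> a i \<in> carrier G"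
    by (rule has_presentationE[OF assms(1)], blast)+
  interpret weak_comm G H \<phi>
    using G assms(2,3) by (simp add: weak_comm_def group_pair_def weak_comm_axioms_def)
  interpret V: group V
    by (rule group_V)
  have R: "R \<subseteq> words (?X <+> ?X)"
    unfolding R_def using r Upsilon_words[of m] by (auto simp: commutator_word_def)
  interpret P: group "presented_group (?X <+> ?X) R"
    using R by (rule group_presented_group)
  let ?P = "presented_group (?X <+> ?X) R" and ?gen = "presented_gen (?X <+> ?X) R"

  have gen_closed: "?gen s \<in> carrier ?P" if "s \<in> ?X <+> ?X" for s
    using that by (simp add: presented_gen_eq presented_class_closed)
  have gen_Inl: "?gen (Inl i) \<in> carrier ?P" and gen_Inr: "?gen (Inr i) \<in> carrier ?P" if "i \<in> ?X" for i
    by (rule gen_closed; use that in blast)+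
  have gen_relator: "word_val ?P ?gen t = \<one>\<^bsub>?P\<^esub>" if "t \<in> R" for t
    using word_val_presented_gen[OF R subsetD[OF R that]] presented_class_relator[OF R that] by (rule trans)
  \<comment> \<open>Within the presented group the commutator relators give exactly the commutation
    assumed by the locale.\<close>
  interpret D: doubled_generators ?P m "\<lambda>i. ?gen (Inl i)" "\<lambda>i. ?gen (Inr i)"
  proof
    fix w assume w: "w \<in> Upsilon m"
    then have words: "unbar_word w \<in> words (?X <+> ?X)" "bar_word w \<in> words (?X <+> ?X)"
      using Upsilon_words[of m] by auto
    have "commutator_word (unbar_word w) (bar_word w) \<in> R"
      using w by (auto simp: R_def)
    then have "commutator ?P (word_val ?P ?gen (unbar_word w)) (word_val ?P ?gen (bar_word w)) = \<one>\<^bsub>?P\<^esub>"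
      using gen_relator P.word_val_commutator_word[of "?X <+> ?X" ?gen, OF _ words] gen_closed
      by metis
    then have "word_val ?P ?gen (unbar_word w) \<otimes>\<^bsub>?P\<^esub> word_val ?P ?gen (bar_word w)
        = word_val ?P ?gen (bar_word w) \<otimes>\<^bsub>?P\<^esub> word_val ?P ?gen (unbar_word w)"
      using P.commutator_eq_one_iff P.word_val_closed[of "?X <+> ?X" ?gen] gen_closed words by blast
    then show "word_val ?P (\<lambda>i. ?gen (Inl i)) w \<otimes>\<^bsub>?P\<^esub> word_val ?P (\<lambda>i. ?gen (Inr i)) w
        = word_val ?P (\<lambda>i. ?gen (Inr i)) w \<otimes>\<^bsub>?P\<^esub> word_val ?P (\<lambda>i. ?gen (Inl i)) w"
      by (simp only: word_val_unbar_word word_val_bar_word)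
  qed (fact gen_Inl gen_Inr)+

  have "word_val ?P (\<lambda>i. ?gen (Inl i)) t = \<one>\<^bsub>?P\<^esub>" if "t \<in> r ` {1..n}" for t
    using that gen_relator[of "unbar_word t"] by (auto simp: R_def word_val_unbar_word)
  then obtain f where f: "f \<in> hom G ?P"
    "\<And>w. w \<in> words ?X \<Longrightarrow> f (word_val G a w) = word_val ?P (\<lambda>i. ?gen (Inl i)) w"
    using has_presentation_lift[OF assms(1) P.is_group, of "\<lambda>i. ?gen (Inl i)"] gen_Inl by blast
  have "word_val ?P (\<lambda>i. ?gen (Inr i)) t = \<one>\<^bsub>?P\<^esub>" if "t \<in> r ` {1..n}" for t
    using that gen_relator[of "bar_word t"] by (auto simp: R_def word_val_bar_word)
  then obtain g where g: "g \<in> hom G ?P"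
    "\<And>w. w \<in> words ?X \<Longrightarrow> g (word_val G a w) = word_val ?P (\<lambda>i. ?gen (Inr i)) w"
    using has_presentation_lift[OF assms(1) P.is_group, of "\<lambda>i. ?gen (Inr i)"] gen_Inr by blast

  \<comment> \<open>The second copy \<open>H\<close> has no presentation of its own at hand, so its
    map is obtained by going back to \<open>G\<close> through the inverse of \<phi>.\<close>
  let ?\<xi> = "inv_into (carrier G) \<phi>"
  have \<xi>: "?\<xi> \<in> hom H G"
    using G.iso_set_sym[OF assms(3)] by (simp add: iso_def)
  have \<xi>_\<phi>: "?\<xi> (\<phi> x) = x" if "x \<in> carrier G" for x
    using that \<phi>_bij by (simp add: bij_betw_inv_into_left)
  \<comment> \<open>An arbitrary element of \<open>G\<close> is the value of some word, so
    commutation on all words yields all defining relations [g, g-bar].\<close>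
  have "f x \<otimes>\<^bsub>?P\<^esub> (g \<circ> ?\<xi>) (\<phi> x) = (g \<circ> ?\<xi>) (\<phi> x) \<otimes>\<^bsub>?P\<^esub> f x" if x: "x \<in> carrier G" for x
  proof -
    obtain w where w: "w \<in> words ?X" "x = word_val G a w"
      using has_presentation_word[OF assms(1) x] .
    then show ?thesis
      using D.commutes_bar_commute[OF D.commutes_bar_all[OF w(1)]] x \<xi>_\<phi> f(2) g(2) by simp
  qed
  then obtain h where h: "h \<in> hom V ?P" "\<And>x. x \<in> carrier G \<Longrightarrow> h (elem (Inl x)) = f x"
    "\<And>y. y \<in> carrier H \<Longrightarrow> h (elem (Inr y)) = (g \<circ> ?\<xi>) y"
    using weak_comm_lift[OF P.is_group f(1) hom_compose[OF \<xi> g(1)]] by blast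

  have c_closed: "c s \<in> carrier V" if "s \<in> ?X <+> ?X" for s
    using that a \<phi>_closed hom_in_carrier[OF elem_Inl_hom] hom_in_carrier[OF elem_Inr_hom]
    by (auto simp: c_def)
  have c_append: "word_val V c (v @ w) = word_val V c v \<otimes>\<^bsub>V\<^esub> word_val V c w"
    if "v \<in> words (?X <+> ?X)" "w \<in> words (?X <+> ?X)" for v w
    using V.word_val_append[of "?X <+> ?X" c] c_closed that by blast
  have c_unbar: "word_val V c (unbar_word w) = elem (Inl (word_val G a w))" if "w \<in> words ?X" for w
    using hom_word_val[OF G group_V elem_Inl_hom a that]
    by (simp add: word_val_unbar_word c_def comp_def)
  have c_bar: "word_val V c (bar_word w) = elem (Inr (\<phi> (word_val G a w)))" if "w \<in> words ?X" for w
    using hom_word_val[OF G group_V hom_compose[OF \<phi>_hom elem_Inr_hom] a that]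
    by (simp add: word_val_bar_word c_def comp_def)

  have "has_presentation V (?X <+> ?X) c R"
  proof (rule has_presentationI[OF group_V R c_closed _ h(1)])
    fix t assume "t \<in> R"
    then consider (unbar) k where "k \<in> {1..n}" "t = unbar_word (r k)"
      | (bar) k where "k \<in> {1..n}" "t = bar_word (r k)"
      | (comm) w where "w \<in> Upsilon m" "t = commutator_word (unbar_word w) (bar_word w)"
      unfolding R_def by blast
    then show "word_val V c t = \<one>\<^bsub>V\<^esub>"
    proof cases
      case unbar
      then have "r k \<in> words ?X" "word_val G a (r k) = \<one>\<^bsub>G\<^esub>"
        using r has_presentation_relator[OF assms(1), of "r k"] by blast+
      then show ?thesis
        using unbar(2) hom_one[OF elem_Inl_hom G group_V] c_unbar[of "r k"] by simp
    next
      case bar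
      then have "r k \<in> words ?X" "word_val G a (r k) = \<one>\<^bsub>G\<^esub>"
        using r has_presentation_relator[OF assms(1), of "r k"] by blast+
      then show ?thesis
        using bar(2) hom_one[OF elem_Inr_hom assms(2) group_V] hom_one[OF \<phi>_hom G assms(2)]
          c_bar[of "r k"] by simp
    next
      case comm
      then have w: "w \<in> words ?X"
        using Upsilon_words[of m] by blast
      then have "word_val G a w \<in> carrier G"
        using G.word_val_closed a by blast
      then have "word_val V c (unbar_word w) \<otimes>\<^bsub>V\<^esub> word_val V c (bar_word w)
          = word_val V c (bar_word w) \<otimes>\<^bsub>V\<^esub> word_val V c (unbar_word w)"
        using elem_commute w c_unbar c_bar by simp
      moreover have words: "unbar_word w \<in> words (?X <+> ?X)" "bar_word w \<in> words (?X <+> ?X)"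
        using w by simp_all
      ultimately have "commutator V (word_val V c (unbar_word w)) (word_val V c (bar_word w)) = \<one>\<^bsub>V\<^esub>"
        using V.commutator_eq_one_iff V.word_val_closed[of "?X <+> ?X" c] c_closed by blast
      then show ?thesis
        using V.word_val_commutator_word[of "?X <+> ?X" c, OF _ words] c_closed comm(2) by metis
    qed
  next
    fix s assume "s \<in> ?X <+> ?X"
    then consider (Inl) i where "i \<in> ?X" "s = Inl i" | (Inr) i where "i \<in> ?X" "s = Inr i"
      by blast
    then show "h (c s) = ?gen s"
    proof cases
      case Inl
      then show ?thesis
        using f(2)[of "[Gen i]"] h(2) a gen_Inl by (simp add: c_def word_val.simps)
    next
      case Inr
      then show ?thesis
        using g(2)[of "[Gen i]"] h(3) a \<phi>_closed \<xi>_\<phi> gen_Inr by (simp add: c_def word_val.simps)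
    qed
  next
    fix v assume "v \<in> carrier V"
    then show "\<exists>w\<in>words (?X <+> ?X). v = word_val V c w"
    proof (induction rule: V_induct)
      case one
      show ?case
        by (rule bexI[of _ "[]"]) simp_all
    next
      case (Inl x v)
      then obtain w where w: "w \<in> words (?X <+> ?X)" "v = word_val V c w"
        by blast
      obtain w' where w': "w' \<in> words ?X" "x = word_val G a w'"
        using has_presentation_word[OF assms(1) Inl(1)] .
      have "elem (Inl x) \<otimes>\<^bsub>V\<^esub> v = word_val V c (unbar_word w' @ w)"
        using c_append[of "unbar_word w'" w] w w' c_unbar by simp
      then show ?case
        using w(1) w'(1) by (intro bexI[of _ "unbar_word w' @ w"]) simp_all
    next
      case (Inr y v)
      then obtain w where w: "w \<in> words (?X <+> ?X)" "v = word_val V c w"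
        by blast
      \<comment> \<open>The word for \<open>y\<close> is that of its preimage in \<open>G\<close>;
        barring it gives a word with value \<open>elem (Inr y)\<close>.\<close>
      have "?\<xi> y \<in> carrier G" and y: "\<phi> (?\<xi> y) = y"
        using Inr(1) hom_in_carrier[OF \<xi>] \<phi>_bij by (simp_all add: bij_betw_inv_into_right)
      then obtain w' where w': "w' \<in> words ?X" "?\<xi> y = word_val G a w'"
        using has_presentation_word[OF assms(1)] by blast
      have "elem (Inr y) \<otimes>\<^bsub>V\<^esub> v = word_val V c (bar_word w' @ w)"
        using c_append[of "bar_word w'" w] w w'(1) c_bar y[unfolded w'(2)] by simp
      then show ?case
        using w(1) w'(1) by (intro bexI[of _ "bar_word w' @ w"]) simp_all
    qed
  qed
  then show ?thesis
    by (simp only: R_def c_def)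
qed

end
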